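(* Let $n\in\mathbb{N}$. Let $(M_{1,n}(\alpha,\theta),\ldots,M_{n,n}(\alpha,\theta))$ be distributed as the Ewens-Pitman sampling model (EP-SM) with parameters $(\alpha,\theta)$, and let $(M_1(\alpha,z,n),\ldots,M_n(\alpha,z,n))$ be distributed as the negative Binomial compound Poisson sampling model (NB-CPSM) with parameters $(\alpha,z)$. Let $\bar X_{\alpha,\theta,n}$ and $\tilde X_{\alpha,z,n}$ be the random variables defined in the context, used as independent randomizations of the parameter $z$ of the NB-CPSM and of the parameter $m$ in the EP-SM with $\theta=-m\alpha$, respectively. Then: (i) for $\alpha\in(0,1)$ and $\theta>-\alpha$, $$(M_{1,n}(\alpha,\theta),\ldots,M_{n,n}(\alpha,\theta))\stackrel{d}{=}(M_1(\alpha,\bar X_{\alpha,\theta,n},n),\ldots,M_n(\alpha,\bar X_{\alpha,\theta,n},n)),$$ where the law of the right-hand side is the mixture, over the law of $\bar X_{\alpha,\theta,n}$, of the NB-CPSM laws: its probability of $(x_1,\ldots,x_n)$ is $\mathbb{E}[p_n(x_1,\ldots,x_n;\alpha,\bar X_{\alpha,\theta,n})]$ with $p_n(x_1,\ldots,x_n;\alpha,z)=\Pr[(M_1(\alpha,z,n),\ldots,M_n(\alpha,z,n))=(x_1,\ldots,x_n)]$; (ii) for $\alpha<0$ and $z<0$, $$(M_1(\alpha,z,n),\ldots,M_n(\alpha,z,n))\stackrel{d}{=}(M_{1,n}(\alpha,-\tilde X_{\alpha,z,n}\alpha),\ldots,M_{n,n}(\alpha,-\tilde X_{\alpha,z,n}\alpha)),$$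 where the law of the right-hand side is the mixture, over the law of $\tilde X_{\alpha,z,n}$, of the EP-SM laws: its probability of $(x_1,\ldots,x_n)$ is $\sum_{m\ge1}\Pr[(M_{1,n}(\alpha,-m\alpha),\ldots,M_{n,n}(\alpha,-m\alpha))=(x_1,\ldots,x_n)]\,\Pr[\tilde X_{\alpha,z,n}=m]$.
   Context: Notation: $\mathbb{N}=\{1,2,\ldots\}$; $(x)_{(n)}=\prod_{0\le i\le n-1}(x+i)$ is the ascending factorial, with $(x)_{(0)}=1$; $\stackrel{d}{=}$ is equality in distribution. Below, $x_1,\ldots,x_n$ are non-negative integers with $\sum_{i=1}^n i\,x_i=n$; all other vectors have probability zero. Generalized factorial coefficients: $\mathscr{C}(n,j;\alpha)=\frac{1}{j!}\sum_{i=0}^{j}\binom{j}{i}(-1)^i(-i\alpha)_{(n)}$, with $\mathscr{C}(0,0;\alpha)=1$, $\mathscr{C}(n,0;\alpha)=0$ for $n\in\mathbb{N}$, and $\mathscr{C}(n,j;\alpha)=0$ for $j>n$. EP-SM: for either $\alpha\in(0,1)$ and $\theta>-\alpha$, or $\alpha<0$ and $\theta=-m\alpha$ for some $m\in\mathbb{N}$, $$\Pr[(M_{1,n}(\alpha,\theta),\ldots,M_{n,n}(\alpha,\theta))=(x_1,\ldots,x_n)]=n!\,\frac{\left(\frac{\theta}{\alpha}\right)_{(\sum_{i=1}^n x_i)}}{(\theta)_{(n)}}\prod_{i=1}^n\frac{\left(\frac{\alpha(1-\alpha)_{(i-1)}}{i!}\right)^{x_i}}{x_i!},$$ where for $\theta=0$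 the ratio $(\theta/\alpha)_{(k)}/(\theta)_{(n)}$ is understood as its limit as $\theta\to0$, i.e. $\frac{(k-1)!}{\alpha\,(n-1)!}$. NB-CPSM: for either $\alpha\in(0,1)$ and $z>0$, or $\alpha<0$ and $z<0$, $$\Pr[(M_1(\alpha,z,n),\ldots,M_n(\alpha,z,n))=(x_1,\ldots,x_n)]=\frac{n!}{\sum_{j=0}^n\mathscr{C}(n,j;\alpha)z^j}\prod_{i=1}^n\frac{\left[z\frac{\alpha(1-\alpha)_{(i-1)}}{i!}\right]^{x_i}}{x_i!}.$$ The variable $\bar X_{\alpha,\theta,n}$: for $\alpha\in(0,1)$ let $f_\alpha$ be the density of the positive $\alpha$-stable random variable $X_\alpha$ with $\mathbb{E}[e^{-tX_\alpha}]=e^{-t^\alpha}$ for $t>0$. For $\alpha\in(0,1)$ and $\theta>-\alpha$ let $S_{\alpha,\theta}$ be the positive random variable with density $$f_{S_{\alpha,\theta}}(s)=\frac{\Gamma(\theta+1)}{\alpha\Gamma(\theta/\alpha+1)}s^{\frac{\theta-1}{\alpha}-1}f_\alpha(s^{-1/\alpha}),\quad s>0.$$ Let $G_{\theta+n,1}$ be a Gamma random variable with shape $\theta+n$ and scale $1$, independent of $S_{\alpha,\theta}$. Then $\bar X_{\alpha,\theta,n}\stackrel{d}{=}G_{\theta+n,1}^{\alpha}\,S_{\alpha,\theta}$. The variable $\tilde X_{\alpha,z,n}$: for $\alpha<0$, $z<0$, it is the $\mathbb{N}$-valued random variable with $$\Pr[\tilde X_{\alpha,z,n}=x]=\frac{1}{\sum_{j=1}^n\mathscr{C}(n,j;\alpha)z^j}\,\frac{e^{z}(-z)^x\,\Gamma(-x\alpha+n)}{x!\,\Gamma(-x\alpha)},\quad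 x\in\mathbb{N}.$$ *)

theory Defs
  imports "HOL-Probability.Probability"
begin

text \<open>
  The ascending factorial is \<^const>\<open>pochhammer\<close>.

  A vector (x_1, ..., x_n) of non-negative integers is represented by the function
  \<open>x :: nat \<Rightarrow> nat\<close> with \<open>x i = x_i\<close> for \<open>1 \<le> i \<le> n\<close> and \<open>x i = 0\<close> for all other \<open>i\<close>.
\<close>

definition count_vectors :: "nat \<Rightarrow> (nat \<Rightarrow> nat) set" where
  "count_vectors n = {x. (\<forall>i. i \<notin> {1..n} \<longrightarrow> x i = 0) \<and> (\<Sum>i=1..n. i * x i) = n}"

text \<open>
  The closed formula below already yields the conventions for (n, j) = (0, 0), for j = 0 < n
  and for j > n.
\<close>

definition gen_fact_coeff :: "nat \<Rightarrow> nat \<Rightarrow> real \<Rightarrow> real" where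
  "gen_fact_coeff n j \<alpha> =
     1 / fact j * (\<Sum>i=0..j. of_nat (j choose i) * (-1) ^ i * pochhammer (- (of_nat i * \<alpha>)) n)"

definition block_weight :: "real \<Rightarrow> nat \<Rightarrow> real" where
  "block_weight \<alpha> i = \<alpha> * pochhammer (1 - \<alpha>) (i - 1) / fact i"

definition EP_ratio :: "nat \<Rightarrow> real \<Rightarrow> real \<Rightarrow> nat \<Rightarrow> real" where
  "EP_ratio n \<alpha> \<theta> k =
     (if \<theta> = 0 then fact (k - 1) / (\<alpha> * fact (n - 1))
      else pochhammer (\<theta> / \<alpha>) k / pochhammer \<theta> n)"

definition EP_SM_mass :: "nat \<Rightarrow> real \<Rightarrow> real \<Rightarrow> (nat \<Rightarrow> nat) \<Rightarrow> real" where
  "EP_SM_mass n \<alpha> \<theta> x =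
     (if x \<in> count_vectors n
      then fact n * EP_ratio n \<alpha> \<theta> (\<Sum>i=1..n. x i) *
           (\<Prod>i=1..n. block_weight \<alpha> i ^ x i / fact (x i))
      else 0)"

definition EP_params :: "real \<Rightarrow> real \<Rightarrow> bool" where
  "EP_params \<alpha> \<theta> \<longleftrightarrow>
     (0 < \<alpha> \<and> \<alpha> < 1 \<and> \<theta> > - \<alpha>) \<or> (\<alpha> < 0 \<and> (\<exists>m::nat. m \<ge> 1 \<and> \<theta> = - of_nat m * \<alpha>))"

text \<open>
  The laws are total functions of their parameters. For parameters outside the admissible range
  they are set to an arbitrary fixed law; in particular \<open>z \<mapsto> NB_CPSM n \<alpha> z\<close> is then measurable on
  all of the real line, so that mixtures over a real random variable that is positive only almost
  surely are meaningful.
\<close>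

definition EP_SM :: "nat \<Rightarrow> real \<Rightarrow> real \<Rightarrow> (nat \<Rightarrow> nat) pmf" where
  "EP_SM n \<alpha> \<theta> =
     (if EP_params \<alpha> \<theta> then embed_pmf (EP_SM_mass n \<alpha> \<theta>) else return_pmf (\<lambda>_. 0))"

definition NB_CPSM_mass :: "nat \<Rightarrow> real \<Rightarrow> real \<Rightarrow> (nat \<Rightarrow> nat) \<Rightarrow> real" where
  "NB_CPSM_mass n \<alpha> z x =
     (if x \<in> count_vectors n
      then fact n / (\<Sum>j=0..n. gen_fact_coeff n j \<alpha> * z ^ j) *
           (\<Prod>i=1..n. (z * block_weight \<alpha> i) ^ x i / fact (x i))
      else 0)"

definition NB_params :: "real \<Rightarrow> real \<Rightarrow> bool" where
  "NB_params \<alpha> z \<longleftrightarrow> (0 < \<alpha> \<and> \<alpha> < 1 \<and> z > 0) \<or> (\<alpha> < 0 \<and> z < 0)"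

definition NB_CPSM :: "nat \<Rightarrow> real \<Rightarrow> real \<Rightarrow> (nat \<Rightarrow> nat) pmf" where
  "NB_CPSM n \<alpha> z =
     (if NB_params \<alpha> z then embed_pmf (NB_CPSM_mass n \<alpha> z) else return_pmf (\<lambda>_. 0))"

definition positive_stable :: "'a measure \<Rightarrow> real \<Rightarrow> ('a \<Rightarrow> real) \<Rightarrow> bool" where
  "positive_stable R \<alpha> X \<longleftrightarrow>
     prob_space R \<and> X \<in> borel_measurable R \<and> (AE \<omega> in R. X \<omega> > 0) \<and>
     (\<forall>t>0. (\<integral>\<omega>. exp (- t * X \<omega>) \<partial>R) = exp (- (t powr \<alpha>)))"

text \<open>In \<open>S_density\<close>, the argument \<open>f\<close> stands for the density of the positive stable variable.\<close>

definition S_density :: "(real \<Rightarrow> real) \<Rightarrow> real \<Rightarrow> real \<Rightarrow> real \<Rightarrow> real" where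
  "S_density f \<alpha> \<theta> s =
     (if s > 0
      then Gamma (\<theta> + 1) / (\<alpha> * Gamma (\<theta> / \<alpha> + 1)) *
           s powr ((\<theta> - 1) / \<alpha> - 1) * f (s powr (- 1 / \<alpha>))
      else 0)"

definition gamma_density :: "real \<Rightarrow> real \<Rightarrow> real" where
  "gamma_density a x = (if x > 0 then x powr (a - 1) * exp (- x) / Gamma a else 0)"

definition tilde_X_mass :: "nat \<Rightarrow> real \<Rightarrow> real \<Rightarrow> nat \<Rightarrow> real" where
  "tilde_X_mass n \<alpha> z x =
     (if x \<ge> 1
      then 1 / (\<Sum>j=1..n. gen_fact_coeff n j \<alpha> * z ^ j) *
           (exp z * (- z) ^ x * Gamma (- of_nat x * \<alpha> + of_nat n) /
            (fact x * Gamma (- of_nat x * \<alpha>)))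
      else 0)"

definition tilde_X_law :: "nat \<Rightarrow> real \<Rightarrow> real \<Rightarrow> nat pmf" where
  "tilde_X_law n \<alpha> z = embed_pmf (tilde_X_mass n \<alpha> z)"

end

theory Submission
  imports Defs
begin

text \<open>
  Write \<open>w\<^sub>i\<close> for the block weight \<open>\<alpha> (1 - \<alpha>)\<^sub>(\<^sub>i\<^sub>-\<^sub>1\<^sub>) / i!\<close>, \<open>C(n, k)\<close> for the generalized factorial
  coefficient, and \<open>S\<^sub>n(z) = \<Sum>\<^sub>k C(n, k) z\<^sup>k\<close>. Both laws give a vector \<open>x\<close> with \<open>k = x\<^sub>1 + \<dots> + x\<^sub>n\<close> blocks
  the same factor \<open>n! \<Prod>\<^sub>i w\<^sub>i^x\<^sub>i / x\<^sub>i!\<close>, multiplied by a function of \<open>k\<close> alone: \<open>z\<^sup>k / S\<^sub>n(z)\<close> for the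
  NB-CPSM and \<open>(\<theta>/\<alpha>)\<^sub>(\<^sub>k\<^sub>) / (\<theta>)\<^sub>(\<^sub>n\<^sub>)\<close> for the EP-SM. Both claims therefore reduce to a one-dimensional
  identity: mixing one function of \<open>k\<close> must produce the other.

  The masses must first be known to be probabilities. The sum of the common factors over all \<open>x\<close>
  with \<open>k\<close> blocks equals \<open>C(n, k)\<close> (\<open>bell_sum_block_weight\<close>), so that the normalizations become
  \<open>\<Sum>\<^sub>k C(n, k) z\<^sup>k = S\<^sub>n(z)\<close>, which is the definition, and \<open>\<Sum>\<^sub>k C(n, k) (\<theta>/\<alpha>)\<^sub>(\<^sub>k\<^sub>) = (\<theta>)\<^sub>(\<^sub>n\<^sub>)\<close>, which follows
  from the triangular recurrence of the coefficients (\<open>sum_pochhammer_gen_fact_coeff\<close>).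

  For \<open>\<alpha> < 0\<close> and \<open>\<theta> = - m \<alpha>\<close> we have \<open>\<theta>/\<alpha> = - m\<close>, and the Gamma quotient in the law of the
  randomized \<open>m\<close> is \<open>(\<theta>)\<^sub>(\<^sub>n\<^sub>)\<close>, which cancels the denominator of the EP-SM. What remains is
  \<open>e\<^sup>z \<Sum>\<^sub>m (- z)\<^sup>m (- m)\<^sub>(\<^sub>k\<^sub>) / m! = z\<^sup>k\<close>: up to signs, this is the factorial moment of order \<open>k\<close> of a
  Poisson variable with parameter \<open>- z\<close> (\<open>sums_falling_factorial_exp\<close>).

  For \<open>0 < \<alpha> < 1\<close>, differentiating the Laplace transform \<open>n\<close> times gives
  \<open>E[X\<^sup>n e\<^sup>-\<^sup>y\<^sup>X] = exp (- y\<^sup>\<alpha>) y\<^sup>-\<^sup>n S\<^sub>n(y\<^sup>\<alpha>)\<close> for a positive stable variable \<open>X\<close>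
  (\<open>tilted_moment_stable\<close>). After the substitutions \<open>s = t\<^sup>-\<^sup>\<alpha>\<close> and \<open>g = t y\<close> in the joint density of
  \<open>G\<close> and \<open>S\<close>, the product \<open>G\<^sup>\<alpha> S\<close> becomes \<open>y\<^sup>\<alpha>\<close>, and integrating out \<open>t\<close> leaves exactly this tilted
  moment. Hence the randomized \<open>z\<close> has a density proportional to
  \<open>z powr (\<theta>/\<alpha> - 1) * exp (- z) * S\<^sub>n(z)\<close> (\<open>nn_integral_Xbar\<close>). The factor \<open>S\<^sub>n(z)\<close> cancels the
  denominator of the NB-CPSM, and a Gamma integral turns \<open>z\<^sup>k\<close> into \<open>\<Gamma>(\<theta>/\<alpha> + k)\<close>, which is
  \<open>(\<theta>/\<alpha>)\<^sub>(\<^sub>k\<^sub>) / (\<theta>)\<^sub>(\<^sub>n\<^sub>)\<close> up to the constant of the density.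
\<close>

section \<open>Count vectors and partial Bell polynomials\<close>

text \<open>
  Up to the factor \<open>n!\<close>, this is the partial Bell polynomial \<open>B\<^sub>n\<^sub>,\<^sub>k\<close> in the variables \<open>i! w\<^sub>i\<close>;
  equivalently, it is the coefficient of \<open>u\<^sup>n\<close> in \<open>(\<Sum>\<^sub>i w\<^sub>i u\<^sup>i)\<^sup>k / k!\<close>.
\<close>

definition bell_sum :: "(nat \<Rightarrow> real) \<Rightarrow> nat \<Rightarrow> nat \<Rightarrow> real" where
  "bell_sum w n k =
     (\<Sum>x\<in>{x\<in>count_vectors n. (\<Sum>i=1..n. x i) = k}. \<Prod>i=1..n. w i ^ x i / fact (x i))"

lemma count_vectors_le:
  assumes "x \<in> count_vectors n" shows "x i \<le> n"
proof (cases "i \<in> {1..n}")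
  case True
  have "i * x i \<le> (\<Sum>i=1..n. i * x i)"
    by (rule member_le_sum) (use True in auto)
  moreover have "x i \<le> i * x i" using True by (cases i) auto
  moreover have "(\<Sum>i=1..n. i * x i) = n" using assms by (simp add: count_vectors_def)
  ultimately show ?thesis by linarith
qed (use assms in \<open>auto simp: count_vectors_def\<close>)

lemma finite_count_vectors: "finite (count_vectors n)"
proof (rule finite_subset)
  show "count_vectors n \<subseteq> {x. \<forall>i. (i \<in> {1..n} \<longrightarrow> x i \<in> {..n}) \<and> (i \<notin> {1..n} \<longrightarrow> x i = 0)}"
  proof
    fix x assume x: "x \<in> count_vectors n"
    have "x i = 0" if "i \<notin> {1..n}" for i using x that by (simp add: count_vectors_def)
    then show "x \<in> {x. \<forall>i. (i \<in> {1..n} \<longrightarrow> x i \<in> {..n}) \<and> (i \<notin> {1..n} \<longrightarrow> x i = 0)}"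
      using count_vectors_le[OF x] by blast
  qed
qed (rule finite_set_of_finite_funs; simp)

lemma count_vectors_0: "count_vectors 0 = {\<lambda>_. 0}"
  by (auto simp: count_vectors_def)

lemma block_number_le:
  assumes "x \<in> count_vectors n" shows "(\<Sum>i=1..n. x i) \<le> n"
proof -
  have "(\<Sum>i=1..n. x i) \<le> (\<Sum>i=1..n. i * x i)" by (rule sum_mono) simp
  then show ?thesis using assms by (simp add: count_vectors_def)
qed

lemma block_number_pos:
  assumes "x \<in> count_vectors n" "n \<ge> 1" shows "(\<Sum>i=1..n. x i) \<ge> 1"
proof (rule ccontr)
  assume "\<not> ?thesis"
  then have "(\<Sum>i=1..n. x i) = 0" by linarith
  then have "\<forall>i\<in>{1..n}. x i = 0" by simp
  then have "(\<Sum>i=1..n. i * x i) = 0" by simp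
  then show False using assms by (simp add: count_vectors_def)
qed

lemma sum_upd_Suc:
  fixes y :: "nat \<Rightarrow> nat" and c :: "nat \<Rightarrow> nat"
  assumes "finite A" "i \<in> A"
  shows "(\<Sum>j\<in>A. c j * (y(i := Suc (y i))) j) = (\<Sum>j\<in>A. c j * y j) + c i"
  using assms by (simp add: sum.remove)

lemma bell_sum_0_0: "bell_sum w 0 0 = 1"
  by (simp add: bell_sum_def count_vectors_0)

lemma bell_sum_0_Suc: "bell_sum w 0 (Suc k) = 0"
  by (simp add: bell_sum_def count_vectors_0)

lemma bell_sum_n_0:
  assumes "n \<ge> 1" shows "bell_sum w n 0 = 0"
proof -
  have no: "{x \<in> count_vectors n. (\<Sum>i=1..n. x i) = 0} = {}"
    using block_number_pos[OF _ assms] by fastforce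
  show ?thesis unfolding bell_sum_def no by simp
qed

lemma bell_sum_eq_0:
  assumes "n < k" shows "bell_sum w n k = 0"
proof -
  have no: "{x \<in> count_vectors n. (\<Sum>i=1..n. x i) = k} = {}"
    using block_number_le[of _ n] assms by fastforce
  show ?thesis unfolding bell_sum_def no by simp
qed

lemma count_vectors_mono_sum:
  assumes "y \<in> count_vectors m" "m \<le> n"
  shows "(\<Sum>j=1..n. c j * y j) = (\<Sum>j=1..m. c j * y j)"
  using assms by (intro sum.mono_neutral_right) (auto simp: count_vectors_def)

text \<open>
  Removing one block of size \<open>i\<close> is a bijection from the vectors of total \<open>n\<close> that have such a block
  onto the vectors of total \<open>n - i\<close>. The multiplicity \<open>x\<^sub>i\<close> on the left turns \<open>1 / x\<^sub>i!\<close> into the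
  factorial that belongs to the smaller vector.
\<close>

lemma bell_sum_marked:
  assumes i: "i \<in> {1..n}"
  shows "(\<Sum>x\<in>{x\<in>count_vectors n. (\<Sum>i=1..n. x i) = Suc k}.
            real (x i) * (\<Prod>i=1..n. w i ^ x i / fact (x i))) = w i * bell_sum w (n - i) k"
    (is "(\<Sum>x\<in>?A. real (x i) * ?P x) = _")
proof -
  let ?B = "{x\<in>count_vectors (n - i). (\<Sum>j=1..n - i. x j) = k}"
  have fin: "finite ?A" using finite_count_vectors by simp
  have up: "y(i := Suc (y i)) \<in> ?A" if "y \<in> ?B" for y
    using that i count_vectors_mono_sum[of y "n - i" n "\<lambda>j. j"]
      count_vectors_mono_sum[of y "n - i" n "\<lambda>j. 1"]
      sum_upd_Suc[of "{1..n}" i "\<lambda>j. j" y] sum_upd_Suc[of "{1..n}" i "\<lambda>j. 1" y]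
    by (auto simp: count_vectors_def)
  have down: "x(i := x i - 1) \<in> ?B" if x: "x \<in> ?A" "x i \<noteq> 0" for x
  proof -
    let ?y = "x(i := x i - 1)"
    have xy: "x = ?y(i := Suc (?y i))" using x by auto
    have s1: "(\<Sum>j=1..n. j * ?y j) + i = n"
      using sum_upd_Suc[of "{1..n}" i "\<lambda>j. j" ?y] i x xy by (simp add: count_vectors_def)
    have s2: "(\<Sum>j=1..n. ?y j) = k"
      using sum_upd_Suc[of "{1..n}" i "\<lambda>j. 1" ?y] i x xy by simp
    \<comment> \<open>A block of size above \<open>n - i\<close> would exceed the total that is left.\<close>
    have z: "?y j = 0" if "j \<notin> {1..n - i}" for j
    proof (cases "j \<in> {1..n}")
      case True
      have "j * ?y j \<le> (\<Sum>j=1..n. j * ?y j)"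
        by (rule member_le_sum) (use True in auto)
      then have "j * ?y j \<le> n - i" using s1 by linarith
      moreover have "j > n - i" using that True by auto
      ultimately show ?thesis by (cases "?y j") auto
    next
      case False
      then show ?thesis using x i by (auto simp: count_vectors_def)
    qed
    have "(\<Sum>j=1..n. c j * ?y j) = (\<Sum>j=1..n - i. c j * ?y j)" for c :: "nat \<Rightarrow> nat"
      using z by (intro sum.mono_neutral_right) auto
    from this[of "\<lambda>j. j"] this[of "\<lambda>j. 1"]
    have "(\<Sum>j=1..n - i. j * ?y j) = n - i" "(\<Sum>j=1..n - i. ?y j) = k"
      using s1 s2 by (linarith, metis (no_types, lifting) mult_1 sum.cong)
    then show ?thesis
      unfolding count_vectors_def using z by blast
  qed
  have P: "real (Suc (y i)) * ?P (y(i := Suc (y i))) = w i * (\<Prod>j=1..n - i. w j ^ y j / fact (y j))"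
    if y: "y \<in> ?B" for y
  proof -
    have "?P (y(i := Suc (y i))) =
      w i ^ Suc (y i) / fact (Suc (y i)) * (\<Prod>j\<in>{1..n} - {i}. w j ^ y j / fact (y j))"
      using i by (subst prod.remove[of _ i]) auto
    then have "real (Suc (y i)) * ?P (y(i := Suc (y i))) =
       w i * (w i ^ y i / fact (y i) * (\<Prod>j\<in>{1..n} - {i}. w j ^ y j / fact (y j)))"
      by (simp add: field_simps del: of_nat_Suc)
    also have "w i ^ y i / fact (y i) * (\<Prod>j\<in>{1..n} - {i}. w j ^ y j / fact (y j)) = ?P y"
      using i by (subst prod.remove[of _ i]) auto
    also have "?P y = (\<Prod>j=1..n - i. w j ^ y j / fact (y j))"
      using y by (intro prod.mono_neutral_right) (auto simp: count_vectors_def)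
    finally show ?thesis .
  qed
  have "(\<Sum>x\<in>?A. real (x i) * ?P x) = (\<Sum>x\<in>{x\<in>?A. x i \<noteq> 0}. real (x i) * ?P x)"
    using fin by (intro sum.mono_neutral_right) auto
  also have "\<dots> = (\<Sum>y\<in>?B. w i * (\<Prod>j=1..n - i. w j ^ y j / fact (y j)))"
  proof (rule sum.reindex_bij_witness[where i = "\<lambda>y. y(i := Suc (y i))" and j = "\<lambda>x. x(i := x i - 1)"])
    fix x assume x: "x \<in> {x\<in>?A. x i \<noteq> 0}"
    let ?y = "x(i := x i - 1)"
    show y: "?y \<in> ?B" using down x by blast
    show xy: "?y(i := Suc (?y i)) = x" using x by auto
    have "real (x i) = real (Suc (?y i))" using x by simp
    with P[OF y] show "w i * (\<Prod>j=1..n - i. w j ^ ?y j / fact (?y j)) = real (x i) * ?P x"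
      by (simp only: xy)
  next
    fix y assume "y \<in> ?B"
    then show "y(i := Suc (y i)) \<in> {x\<in>?A. x i \<noteq> 0}" using up by simp
  qed auto
  finally show ?thesis by (simp add: bell_sum_def sum_distrib_left)
qed

text \<open>
  Since \<open>n = \<Sum>\<^sub>i i x\<^sub>i\<close>, the factor \<open>n\<close> marks one of the \<open>n\<close> elements, and the sum is split by the
  size of the block that contains it. In terms of generating functions with \<open>W = \<Sum>\<^sub>i w\<^sub>i u\<^sup>i\<close>, this is
  the derivative of \<open>W\<^sup>k\<^sup>+\<^sup>1 / (k + 1)!\<close>.
\<close>

lemma bell_sum_rec:
  "real n * bell_sum w n (Suc k) = (\<Sum>i=1..n. real i * w i * bell_sum w (n - i) k)"
proof -
  let ?A = "{x\<in>count_vectors n. (\<Sum>i=1..n. x i) = Suc k}"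
  let ?P = "\<lambda>x. \<Prod>i=1..n. w i ^ x i / fact (x i)"
  have "real n * bell_sum w n (Suc k) = (\<Sum>x\<in>?A. real (\<Sum>i=1..n. i * x i) * ?P x)"
    unfolding bell_sum_def sum_distrib_left by (intro sum.cong) (auto simp: count_vectors_def)
  also have "\<dots> = (\<Sum>i=1..n. \<Sum>x\<in>?A. real i * (real (x i) * ?P x))"
    by (subst sum.swap) (simp add: sum_distrib_right mult.assoc)
  also have "\<dots> = (\<Sum>i=1..n. real i * w i * bell_sum w (n - i) k)"
    unfolding sum_distrib_left[symmetric]
    by (intro sum.cong refl) (simp only: bell_sum_marked mult.assoc)
  finally show ?thesis .
qed

section \<open>Generalized factorial coefficients\<close>

lemma gen_fact_coeff_0: "gen_fact_coeff 0 k \<alpha> = (if k = 0 then 1 else 0)"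
  using choose_alternating_sum[of k, where ?'a = real]
  by (auto simp: gen_fact_coeff_def mult.commute atLeast0AtMost)

lemma gen_fact_coeff_n_0: "n \<ge> 1 \<Longrightarrow> gen_fact_coeff n 0 \<alpha> = 0"
  by (simp add: gen_fact_coeff_def pochhammer_0_left)

text \<open>
  Vandermonde's identity for rising factorials, divided by \<open>n!\<close>. The index is shifted by one to fit
  the block sizes, which start at 1.
\<close>

lemma pochhammer_over_fact_convolution:
  fixes a b :: real
  shows "(\<Sum>i=1..Suc n. pochhammer a (i - 1) / fact (i - 1) *
             (pochhammer b (Suc n - i) / fact (Suc n - i)))
         = pochhammer (a + b) n / fact n"
proof -
  have "(\<Sum>i=1..Suc n. pochhammer a (i - 1) / fact (i - 1) *
             (pochhammer b (Suc n - i) / fact (Suc n - i)))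
      = (\<Sum>k\<le>n. pochhammer a k / fact k * (pochhammer b (n - k) / fact (n - k)))"
    by (intro sum.reindex_bij_witness[where i = Suc and j = "\<lambda>i. i - 1"]) auto
  also have "\<dots> = (\<Sum>k\<le>n. real (n choose k) * pochhammer a k * pochhammer b (n - k)) / fact n"
    unfolding sum_divide_distrib
    by (intro sum.cong) (auto simp: binomial_fact field_simps)
  finally show ?thesis by (simp add: pochhammer_binomial_sum)
qed

lemma block_weight_pochhammer:
  assumes "i \<ge> 1"
  shows "real i * block_weight \<alpha> i = \<alpha> * (pochhammer (1 - \<alpha>) (i - 1) / fact (i - 1))"
  using assms by (cases i) (simp_all add: block_weight_def del: of_nat_Suc)

text \<open>
  The recurrence of \<open>bell_sum_rec\<close>, satisfied by \<open>C(n, k) / n!\<close>. Inside the alternating sum over \<open>l\<close>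
  that defines the coefficients, Vandermonde's identity evaluates the convolution with \<open>i w\<^sub>i\<close>; it
  raises \<open>- l \<alpha>\<close> to \<open>- (l + 1) \<alpha>\<close> at the price of a factor \<open>- 1 / (l + 1)\<close>, and the absorption
  identity for binomial coefficients turns this factor into the alternating sum for \<open>k + 1\<close>.
\<close>

lemma gen_fact_coeff_rec:
  assumes "n \<ge> 1"
  shows "real n * (gen_fact_coeff n (Suc k) \<alpha> / fact n) =
    (\<Sum>i=1..n. real i * block_weight \<alpha> i * (gen_fact_coeff (n - i) k \<alpha> / fact (n - i)))"
proof -
  obtain m where n: "n = Suc m" using assms by (cases n) auto
  let ?b = "\<lambda>k l. real (k choose l) * (- 1) ^ l"
  let ?p = "\<lambda>l n. pochhammer (- (real l * \<alpha>)) n"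
  have conv: "(\<Sum>i=1..n. real i * block_weight \<alpha> i * (?p l (n - i) / fact (n - i)))
      = - ?p (Suc l) n / (real (Suc l) * fact m)" for l
  proof -
    have "(\<Sum>i=1..n. real i * block_weight \<alpha> i * (?p l (n - i) / fact (n - i)))
      = \<alpha> * (\<Sum>i=1..Suc m. pochhammer (1 - \<alpha>) (i - 1) / fact (i - 1) *
             (?p l (Suc m - i) / fact (Suc m - i)))"
      unfolding sum_distrib_left n
      by (intro sum.cong) (simp_all add: block_weight_pochhammer mult.assoc)
    also have "\<dots> = \<alpha> * (pochhammer (1 - \<alpha> + - (real l * \<alpha>)) m / fact m)"
      by (subst pochhammer_over_fact_convolution) simp
    also have "1 - \<alpha> + - (real l * \<alpha>) = - (real (Suc l) * \<alpha>) + 1"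
      by (simp add: algebra_simps)
    also have "\<alpha> * (pochhammer (- (real (Suc l) * \<alpha>) + 1) m / fact m)
        = - ?p (Suc l) n / (real (Suc l) * fact m)"
      unfolding n by (subst pochhammer_rec) (simp add: field_simps del: of_nat_Suc)
    finally show ?thesis .
  qed
  have "(\<Sum>i=1..n. real i * block_weight \<alpha> i * (gen_fact_coeff (n - i) k \<alpha> / fact (n - i)))
     = (\<Sum>i=1..n. \<Sum>l=0..k. ?b k l / fact k *
          (real i * block_weight \<alpha> i * (?p l (n - i) / fact (n - i))))"
    by (intro sum.cong)
       (simp_all add: gen_fact_coeff_def sum_distrib_left sum_divide_distrib mult_ac)
  also have "\<dots> = (\<Sum>l=0..k. ?b k l / fact k * (- ?p (Suc l) n / (real (Suc l) * fact m)))"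
    by (subst sum.swap) (simp only: conv sum_distrib_left[symmetric])
  also have "\<dots> = (\<Sum>l=0..k. ?b (Suc k) (Suc l) / fact (Suc k) * ?p (Suc l) n / fact m)"
  proof (rule sum.cong[OF refl])
    fix l
    have "real (Suc k) * real (k choose l) = real (Suc l) * real (Suc k choose Suc l)"
      unfolding of_nat_mult[symmetric] by (simp only: Suc_times_binomial_eq mult.commute)
    then have "real (k choose l) / (fact k * real (Suc l)) = real (Suc k choose Suc l) / fact (Suc k)"
      by (simp add: field_simps del: of_nat_Suc binomial_Suc_Suc)
    then show "?b k l / fact k * (- ?p (Suc l) n / (real (Suc l) * fact m)) =
         ?b (Suc k) (Suc l) / fact (Suc k) * ?p (Suc l) n / fact m"
      by (simp add: field_simps del: of_nat_Suc binomial_Suc_Suc fact_Suc)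
  qed
  \<comment> \<open>The new summand at \<open>l = 0\<close> vanishes because \<open>n \<ge> 1\<close>.\<close>
  also have "\<dots> = (\<Sum>l=0..Suc k. ?b (Suc k) l / fact (Suc k) * ?p l n / fact m)"
    unfolding n sum.atLeast0_atMost_Suc_shift[of _ k] by (simp add: pochhammer_0_left del: binomial_Suc_Suc fact_Suc)
  also have "\<dots> = real n * (gen_fact_coeff n (Suc k) \<alpha> / fact n)"
  proof -
    have "real n / fact n = 1 / fact m"
      unfolding n by (simp del: of_nat_Suc)
    then have "real n * (gen_fact_coeff n (Suc k) \<alpha> / fact n) = gen_fact_coeff n (Suc k) \<alpha> / fact m"
      by (metis mult.commute mult.right_neutral times_divide_eq_left times_divide_eq_right)
    then show ?thesis
      unfolding gen_fact_coeff_def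
      by (simp only: sum_distrib_left sum_divide_distrib times_divide_eq_left mult_1)
  qed
  finally show ?thesis by simp
qed

text \<open>
  Both sides satisfy the same recurrence and have the same initial values. This is the link between
  the closed formula for \<open>C(n, k)\<close> and the sampling models.
\<close>

lemma bell_sum_block_weight: "bell_sum (block_weight \<alpha>) n k = gen_fact_coeff n k \<alpha> / fact n"
proof (induction n arbitrary: k rule: less_induct)
  case (less n)
  consider "n = 0" | "n \<ge> 1" "k = 0" | k' where "n \<ge> 1" "k = Suc k'"
    by (cases k; cases n) auto
  then show ?case
  proof cases
    case 1
    then show ?thesis
      by (cases k) (simp_all add: bell_sum_0_0 bell_sum_0_Suc gen_fact_coeff_0)
  next
    case 2
    then show ?thesis by (simp add: bell_sum_n_0 gen_fact_coeff_n_0)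
  next
    case 3
    have "real n * bell_sum (block_weight \<alpha>) n k = real n * (gen_fact_coeff n k \<alpha> / fact n)"
      unfolding 3(2) bell_sum_rec gen_fact_coeff_rec[OF 3(1)]
      using 3(1) by (intro sum.cong) (simp_all add: less.IH)
    then show ?thesis using 3(1) by (simp del: times_divide_eq_right)
  qed
qed

text \<open>
  A vector of total \<open>n\<close> has at most \<open>n\<close> blocks.
\<close>

lemma gen_fact_coeff_eq_0: "n < k \<Longrightarrow> gen_fact_coeff n k \<alpha> = 0"
  using bell_sum_block_weight[of \<alpha> n k] bell_sum_eq_0[of n k] by simp

text \<open>
  The weights of both models depend on \<open>x\<close> only through the common product and the number of blocks,
  so this identity reduces their normalizations to sums over \<open>k\<close>.
\<close>

lemma sum_count_vectors_by_block_number: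
  "(\<Sum>x\<in>count_vectors n. g (\<Sum>i=1..n. x i) * (\<Prod>i=1..n. block_weight \<alpha> i ^ x i / fact (x i)))
   = (\<Sum>k=0..n. g k * gen_fact_coeff n k \<alpha>) / fact n"
proof -
  have "(\<Sum>x\<in>count_vectors n. g (\<Sum>i=1..n. x i) * (\<Prod>i=1..n. block_weight \<alpha> i ^ x i / fact (x i)))
     = (\<Sum>k=0..n. \<Sum>x\<in>{x\<in>count_vectors n. (\<Sum>i=1..n. x i) = k}.
          g (\<Sum>i=1..n. x i) * (\<Prod>i=1..n. block_weight \<alpha> i ^ x i / fact (x i)))"
    using block_number_le by (intro sum.group[symmetric]) (auto simp: finite_count_vectors)
  also have "\<dots> = (\<Sum>k=0..n. g k * bell_sum (block_weight \<alpha>) n k)"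
    unfolding bell_sum_def sum_distrib_left by (intro sum.cong) auto
  finally show ?thesis by (simp add: bell_sum_block_weight sum_divide_distrib)
qed

text \<open>
  The last factor \<open>n - l \<alpha>\<close> of the rising factorial is split as
  \<open>(n - (k + 1) \<alpha>) + (k + 1 - l) \<alpha>\<close>; the second part lowers \<open>k + 1\<close> to \<open>k\<close> by absorption.
\<close>

lemma gen_fact_coeff_Suc_Suc:
  "gen_fact_coeff (Suc n) (Suc k) \<alpha> =
     (real n - real (Suc k) * \<alpha>) * gen_fact_coeff n (Suc k) \<alpha> + \<alpha> * gen_fact_coeff n k \<alpha>"
proof -
  let ?p = "\<lambda>l n. pochhammer (- (real l * \<alpha>)) n"
  have split: "real (Suc k choose l) * (-1) ^ l * ?p l (Suc n) =
     (real n - real (Suc k) * \<alpha>) * (real (Suc k choose l) * (-1) ^ l * ?p l n)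
     + \<alpha> * real (Suc k) * (real (k choose l) * (-1) ^ l * ?p l n)" if "l \<le> Suc k" for l
  proof -
    have "Suc k * (k choose l) = (Suc k - l) * (Suc k choose l)"
      using binomial_absorb_comp[of "Suc k" l] by (simp only: diff_Suc_1)
    then have "real (Suc k) * real (k choose l) = (real (Suc k) - real l) * real (Suc k choose l)"
      using that by (simp only: of_nat_mult[symmetric] of_nat_diff[symmetric])
    moreover have "b * s * (p * (- (L * \<alpha>) + m)) = (m - A * \<alpha>) * (b * s * p) + \<alpha> * A * (c * s * p)"
      if "A * c = (A - L) * b" for A b c L m p s :: real
    proof -
      have "\<alpha> * A * (c * s * p) = \<alpha> * (A * c) * s * p" by simp
      then show ?thesis unfolding that by (simp add: algebra_simps)
    qed
    ultimately show ?thesis unfolding pochhammer_Suc by blast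
  qed
  have "(\<Sum>l=0..Suc k. real (Suc k choose l) * (-1) ^ l * ?p l (Suc n)) =
      (real n - real (Suc k) * \<alpha>) * (\<Sum>l=0..Suc k. real (Suc k choose l) * (-1) ^ l * ?p l n)
      + \<alpha> * real (Suc k) * (\<Sum>l=0..Suc k. real (k choose l) * (-1) ^ l * ?p l n)"
    unfolding sum_distrib_left sum.distrib[symmetric]
    by (rule sum.cong[OF refl], rule split) simp
  also have "(\<Sum>l=0..Suc k. real (k choose l) * (-1) ^ l * ?p l n) =
      (\<Sum>l=0..k. real (k choose l) * (-1) ^ l * ?p l n)"
    by simp
  finally have rec: "(\<Sum>l=0..Suc k. real (Suc k choose l) * (-1) ^ l * ?p l (Suc n)) =
      (real n - real (Suc k) * \<alpha>) * (\<Sum>l=0..Suc k. real (Suc k choose l) * (-1) ^ l * ?p l n)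
      + \<alpha> * real (Suc k) * (\<Sum>l=0..k. real (k choose l) * (-1) ^ l * ?p l n)" .
  have "1 / (s * F) * X = A * (1 / (s * F) * Y) + \<alpha> * (1 / F * Z)"
    if "X = A * Y + \<alpha> * s * Z" "s \<noteq> 0" "F \<noteq> 0" for X A Y s Z F :: real
    using that by (simp add: field_simps)
  from this[OF rec] show ?thesis
    unfolding gen_fact_coeff_def fact_Suc by simp
qed

text \<open>
  The triangular recurrence in summed form. It serves two different choices of \<open>q\<close>: rising
  factorials for the normalization of the EP-SM, and powers of \<open>y\<close> for the derivatives of
  \<open>exp (- y\<^sup>\<alpha>)\<close>.
\<close>

lemma sum_gen_fact_coeff_Suc:
  "(\<Sum>k=0..Suc n. gen_fact_coeff (Suc n) k \<alpha> * q k) =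
     (\<Sum>k=0..n. gen_fact_coeff n k \<alpha> * ((real n - real k * \<alpha>) * q k + \<alpha> * q (Suc k)))"
proof -
  let ?C = "\<lambda>n k. gen_fact_coeff n k \<alpha>"
  let ?r = "\<lambda>k. (real n - real k * \<alpha>) * ?C n k * q k"
  have "(\<Sum>k=0..Suc n. ?C (Suc n) k * q k) = (\<Sum>k=0..n. ?C (Suc n) (Suc k) * q (Suc k))"
    unfolding sum.atLeast0_atMost_Suc_shift by (simp add: gen_fact_coeff_n_0)
  also have "\<dots> = (\<Sum>k=0..n. ?r (Suc k)) + (\<Sum>k=0..n. \<alpha> * ?C n k * q (Suc k))"
    unfolding sum.distrib[symmetric] gen_fact_coeff_Suc_Suc
    by (intro sum.cong refl) (simp only: ring_distribs)
  also have "(\<Sum>k=0..n. ?r (Suc k)) = (\<Sum>k=0..Suc n. ?r k)"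
  proof -
    have "?r 0 = 0" by (cases n) (simp_all add: gen_fact_coeff_n_0)
    then show ?thesis unfolding sum.atLeast0_atMost_Suc_shift by simp
  qed
  also have "\<dots> = (\<Sum>k=0..n. ?r k)" by (simp add: gen_fact_coeff_eq_0)
  finally show ?thesis by (simp add: sum.distrib[symmetric] algebra_simps)
qed

text \<open>
  This is \<open>\<Sum>\<^sub>k C(n, k) (a)\<^sub>(\<^sub>k\<^sub>) = (a \<alpha>)\<^sub>(\<^sub>n\<^sub>)\<close> with a factor \<open>a\<close> divided out of both sides. In this form it
  also covers \<open>a = 0\<close>, which is the limiting case \<open>\<theta> = 0\<close> of the EP-SM. At \<open>k = 0\<close> the truncated
  exponent \<open>k - 1\<close> is harmless since the coefficient is zero.
\<close>

lemma sum_pochhammer_gen_fact_coeff: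
  fixes a :: real
  shows "(\<Sum>k=0..Suc n. gen_fact_coeff (Suc n) k \<alpha> * pochhammer (a + 1) (k - 1))
         = \<alpha> * pochhammer (a * \<alpha> + 1) n"
proof (induction n)
  case 0
  then show ?case by (simp add: gen_fact_coeff_def)
next
  case (Suc n)
  let ?C = "\<lambda>k. gen_fact_coeff (Suc n) k \<alpha>"
  let ?q = "\<lambda>k. pochhammer (a + 1) (k - 1)"
  have "?C k * ((real (Suc n) - real k * \<alpha>) * ?q k + \<alpha> * ?q (Suc k)) =
      ?C k * ?q k * (a * \<alpha> + 1 + real n)" for k
  proof (cases k)
    case 0
    then show ?thesis by (simp add: gen_fact_coeff_n_0)
  next
    case (Suc l)
    then show ?thesis by (simp add: pochhammer_Suc algebra_simps)
  qed
  then show ?case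
    unfolding sum_gen_fact_coeff_Suc[of "Suc n"]
    by (simp only: sum_distrib_right[symmetric] Suc.IH) (simp add: pochhammer_Suc)
qed

section \<open>The two sampling models as probability laws\<close>

lemma pmf_embed_pmf_finite:
  assumes "\<And>x. f x \<ge> 0" "finite A" "\<And>x. x \<notin> A \<Longrightarrow> f x = 0" "sum f A = 1"
  shows "pmf (embed_pmf f) x = f x"
proof (rule pmf_embed_pmf)
  have "(\<integral>\<^sup>+x. ennreal (f x) \<partial>count_space UNIV) = (\<Sum>x\<in>A. ennreal (f x))"
    by (rule nn_integral_count_space') (use assms in auto)
  then show "(\<integral>\<^sup>+x. ennreal (f x) \<partial>count_space UNIV) = 1"
    using assms by simp
qed (rule assms)

lemma block_weight_pos: "0 < \<alpha> \<Longrightarrow> \<alpha> < 1 \<Longrightarrow> block_weight \<alpha> i > 0"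
  by (simp add: block_weight_def pochhammer_pos)

lemma block_weight_neg: "\<alpha> < 0 \<Longrightarrow> block_weight \<alpha> i < 0"
  by (simp add: block_weight_def pochhammer_pos divide_neg_pos mult_neg_pos)

text \<open>
  The polynomial \<open>S\<^sub>n\<close> above: it normalizes the NB-CPSM and reappears in the tilted moments of the
  stable law.
\<close>

definition nb_norm :: "nat \<Rightarrow> real \<Rightarrow> real \<Rightarrow> real" where
  "nb_norm n \<alpha> z = (\<Sum>j=0..n. gen_fact_coeff n j \<alpha> * z ^ j)"

lemma nb_norm_from_1:
  assumes "n \<ge> 1" shows "nb_norm n \<alpha> z = (\<Sum>j=1..n. gen_fact_coeff n j \<alpha> * z ^ j)"
  using assms by (simp add: nb_norm_def sum.atLeast_Suc_atMost gen_fact_coeff_n_0)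

lemma prod_block_weight_scale:
  "(\<Prod>i=1..n. (z * block_weight \<alpha> i) ^ x i / fact (x i)) =
     z ^ (\<Sum>i=1..n. x i) * (\<Prod>i=1..n. block_weight \<alpha> i ^ x i / fact (x i))"
  by (simp add: power_sum power_mult_distrib flip: prod.distrib)

lemma sum_nb_weights:
  "(\<Sum>x\<in>count_vectors n. \<Prod>i=1..n. (z * block_weight \<alpha> i) ^ x i / fact (x i)) = nb_norm n \<alpha> z / fact n"
  unfolding prod_block_weight_scale
  by (subst sum_count_vectors_by_block_number) (simp add: nb_norm_def mult.commute)

lemma count_vectors_nonempty: "count_vectors n \<noteq> {}"
proof -
  have "(\<Sum>i=1..n. i * (if i = n then 1 else 0)) = n" by (cases n) auto
  then have "(\<lambda>i. if i = n \<and> n \<noteq> 0 then 1 else 0) \<in> count_vectors n"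
    unfolding count_vectors_def by (auto cong: if_cong)
  then show ?thesis by blast
qed

text \<open>
  For \<open>\<alpha> < 1\<close> the weights have the sign of \<open>\<alpha>\<close>, and the admissible \<open>z\<close> are those with the sign of \<open>\<alpha>\<close>.
\<close>

lemma NB_params_weight_pos: "NB_params \<alpha> z \<Longrightarrow> z * block_weight \<alpha> i > 0"
  by (auto simp: NB_params_def block_weight_pos block_weight_neg mult_neg_neg)

lemma nb_norm_pos:
  assumes "NB_params \<alpha> z" shows "nb_norm n \<alpha> z > 0"
proof -
  have "(\<Sum>x\<in>count_vectors n. \<Prod>i=1..n. (z * block_weight \<alpha> i) ^ x i / fact (x i)) > 0"
    using NB_params_weight_pos[OF assms] finite_count_vectors count_vectors_nonempty
    by (intro sum_pos prod_pos) auto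
  then show ?thesis unfolding sum_nb_weights by (simp add: zero_less_divide_iff)
qed

lemma NB_CPSM_mass_eq:
  assumes "x \<in> count_vectors n"
  shows "NB_CPSM_mass n \<alpha> z x = fact n / nb_norm n \<alpha> z * z ^ (\<Sum>i=1..n. x i) *
           (\<Prod>i=1..n. block_weight \<alpha> i ^ x i / fact (x i))"
  using assms unfolding NB_CPSM_mass_def prod_block_weight_scale nb_norm_def[symmetric] by simp

lemma sum_NB_CPSM_mass:
  assumes "NB_params \<alpha> z"
  shows "(\<Sum>x\<in>count_vectors n. NB_CPSM_mass n \<alpha> z x) = 1"
proof -
  have "(\<Sum>x\<in>count_vectors n. NB_CPSM_mass n \<alpha> z x) = fact n / nb_norm n \<alpha> z *
     (\<Sum>x\<in>count_vectors n. \<Prod>i=1..n. (z * block_weight \<alpha> i) ^ x i / fact (x i))"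
    by (simp add: NB_CPSM_mass_def nb_norm_def sum_distrib_left)
  then show ?thesis unfolding sum_nb_weights using nb_norm_pos[OF assms, of n] by simp
qed

lemma NB_CPSM_mass_nonneg:
  assumes "NB_params \<alpha> z"
  shows "NB_CPSM_mass n \<alpha> z x \<ge> 0"
proof -
  have "(\<Prod>i=1..n. (z * block_weight \<alpha> i) ^ x i / fact (x i)) \<ge> 0"
    using NB_params_weight_pos[OF assms] by (intro prod_nonneg) (simp add: less_imp_le)
  then show ?thesis
    using nb_norm_pos[OF assms, of n] by (simp add: NB_CPSM_mass_def nb_norm_def)
qed

lemma pmf_NB_CPSM:
  assumes "NB_params \<alpha> z"
  shows "pmf (NB_CPSM n \<alpha> z) x = NB_CPSM_mass n \<alpha> z x"
proof -
  have "pmf (embed_pmf (NB_CPSM_mass n \<alpha> z)) x = NB_CPSM_mass n \<alpha> z x"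
    by (rule pmf_embed_pmf_finite[where A = "count_vectors n"])
       (simp_all add: NB_CPSM_mass_nonneg sum_NB_CPSM_mass finite_count_vectors assms,
        simp add: NB_CPSM_mass_def)
  then show ?thesis using assms by (simp add: NB_CPSM_def)
qed

text \<open>
  A factor \<open>\<theta>\<close> cancels between \<open>(\<theta>/\<alpha>)\<^sub>(\<^sub>k\<^sub>)\<close> and \<open>(\<theta>)\<^sub>(\<^sub>n\<^sub>)\<close>. The cancelled form makes sense for \<open>\<theta> = 0\<close> and
  yields the limiting value there, so that no later argument has to treat this case separately. For
  \<open>- \<alpha> < \<theta> < 0\<close> it also shows that the ratio is positive, although both rising factorials are
  negative.
\<close>

lemma EP_ratio_eq:
  assumes "n \<ge> 1" "k \<ge> 1" "\<alpha> \<noteq> 0"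
  shows "EP_ratio n \<alpha> \<theta> k =
    pochhammer (\<theta> / \<alpha> + 1) (k - 1) / (\<alpha> * pochhammer (\<theta> + 1) (n - 1))"
proof (cases "\<theta> = 0")
  case True
  then show ?thesis by (simp add: EP_ratio_def pochhammer_fact)
next
  case False
  obtain m l where "n = Suc m" "k = Suc l" using assms by (metis One_nat_def Suc_le_D)
  with False show ?thesis by (simp add: EP_ratio_def pochhammer_rec)
qed

lemma sum_EP_SM_mass:
  assumes n: "n \<ge> 1" and \<alpha>: "\<alpha> \<noteq> 0" and \<theta>: "\<theta> > -1"
  shows "(\<Sum>x\<in>count_vectors n. EP_SM_mass n \<alpha> \<theta> x) = 1"
proof -
  obtain m where m: "n = Suc m" using n by (cases n) auto
  have q: "pochhammer (\<theta> + 1) m > 0" using \<theta> by (intro pochhammer_pos) simp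
  have "(\<Sum>x\<in>count_vectors n. EP_SM_mass n \<alpha> \<theta> x) =
    fact n * (\<Sum>x\<in>count_vectors n. EP_ratio n \<alpha> \<theta> (\<Sum>i=1..n. x i) *
           (\<Prod>i=1..n. block_weight \<alpha> i ^ x i / fact (x i)))"
    unfolding sum_distrib_left by (intro sum.cong) (auto simp: EP_SM_mass_def)
  also have "\<dots> = (\<Sum>k=0..n. EP_ratio n \<alpha> \<theta> k * gen_fact_coeff n k \<alpha>)"
    by (subst sum_count_vectors_by_block_number) simp
  also have "\<dots> = (\<Sum>k=0..n. gen_fact_coeff n k \<alpha> * pochhammer (\<theta> / \<alpha> + 1) (k - 1))
      / (\<alpha> * pochhammer (\<theta> + 1) (n - 1))"
    unfolding sum_divide_distrib
  proof (intro sum.cong refl)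
    fix k
    show "EP_ratio n \<alpha> \<theta> k * gen_fact_coeff n k \<alpha> =
      gen_fact_coeff n k \<alpha> * pochhammer (\<theta> / \<alpha> + 1) (k - 1) / (\<alpha> * pochhammer (\<theta> + 1) (n - 1))"
      using n \<alpha> by (cases "k = 0") (simp_all add: gen_fact_coeff_n_0 EP_ratio_eq)
  qed
  also have "\<dots> = 1"
    unfolding m sum_pochhammer_gen_fact_coeff using \<alpha> q by simp
  finally show ?thesis .
qed

text \<open>
  Up to sign, \<open>(- m)\<^sub>(\<^sub>k\<^sub>)\<close> is the falling factorial \<open>m (m - 1) \<dots> (m - k + 1)\<close>.
\<close>

lemma pochhammer_minus_of_nat:
  assumes "k \<le> m"
  shows "(-1) ^ k * pochhammer (- real m) k = fact m / fact (m - k)"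
  using assms
proof (induction k)
  case (Suc k)
  obtain d where d: "m = Suc (k + d)" using Suc.prems less_iff_Suc_add by (auto simp: Suc_le_eq)
  have "(-1) ^ Suc k * pochhammer (- real m) (Suc k) =
      (real m - real k) * ((-1) ^ k * pochhammer (- real m) k)"
    by (simp add: pochhammer_Suc algebra_simps)
  also have "\<dots> = real (Suc d) * (fact m / fact (Suc d))"
    using Suc d by simp
  also have "\<dots> = fact m / fact (m - Suc k)"
    using d by (simp del: of_nat_Suc)
  finally show ?case .
qed simp

lemma pochhammer_minus_of_nat_sign: "(-1) ^ k * pochhammer (- real m) k \<ge> 0"
proof (cases "k \<le> m")
  case True
  then show ?thesis by (simp add: pochhammer_minus_of_nat)
next
  case False
  then show ?thesis by (simp add: pochhammer_of_nat_eq_0_lemma)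
qed

text \<open>
  For \<open>\<alpha> < 0\<close> both \<open>(- m)\<^sub>(\<^sub>k\<^sub>)\<close> and the product of the \<open>k\<close> negative block weights carry the sign
  \<open>(- 1)\<^sup>k\<close>, and the two signs cancel.
\<close>

lemma EP_SM_mass_nonneg:
  assumes "n \<ge> 1" "EP_params \<alpha> \<theta>"
  shows "EP_SM_mass n \<alpha> \<theta> x \<ge> 0"
proof (cases "x \<in> count_vectors n")
  case x: True
  let ?k = "\<Sum>i=1..n. x i"
  have k: "?k \<ge> 1" using block_number_pos[OF x assms(1)] .
  have "EP_ratio n \<alpha> \<theta> ?k * (\<Prod>i=1..n. block_weight \<alpha> i ^ x i / fact (x i)) \<ge> 0"
  proof (cases "\<alpha> < 0")
    case False
    then have a: "0 < \<alpha>" "\<alpha> < 1" "\<theta> > - \<alpha>" using assms(2) by (auto simp: EP_params_def)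
    then have "\<theta> / \<alpha> + 1 > 0" by (simp add: field_simps)
    then have "EP_ratio n \<alpha> \<theta> ?k > 0"
      using a k assms(1) by (simp add: EP_ratio_eq pochhammer_pos)
    moreover have "(\<Prod>i=1..n. block_weight \<alpha> i ^ x i / fact (x i)) > 0"
      using block_weight_pos[OF a(1,2)] by (intro prod_pos) simp
    ultimately show ?thesis by simp
  next
    case True
    then obtain m :: nat where m: "m \<ge> 1" "\<theta> = - real m * \<alpha>"
      using assms(2) by (auto simp: EP_params_def)
    have \<theta>: "\<theta> > 0" using m True by (simp add: mult_pos_neg)
    have "EP_ratio n \<alpha> \<theta> ?k = pochhammer (- real m) ?k / pochhammer \<theta> n"
      using \<theta> m True by (simp add: EP_ratio_def)
    moreover have "(\<Prod>i=1..n. block_weight \<alpha> i ^ x i / fact (x i)) =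
        (-1) ^ ?k * (\<Prod>i=1..n. (- 1 * block_weight \<alpha> i) ^ x i / fact (x i))"
      unfolding prod_block_weight_scale by (simp flip: mult.assoc power_add)
    ultimately have "EP_ratio n \<alpha> \<theta> ?k * (\<Prod>i=1..n. block_weight \<alpha> i ^ x i / fact (x i)) =
       (-1) ^ ?k * pochhammer (- real m) ?k / pochhammer \<theta> n *
       (\<Prod>i=1..n. (- 1 * block_weight \<alpha> i) ^ x i / fact (x i))"
      by simp
    also have "\<dots> \<ge> 0"
    proof (intro mult_nonneg_nonneg[OF divide_nonneg_nonneg] prod_nonneg)
      show "pochhammer \<theta> n \<ge> 0" using \<theta> by (rule pochhammer_nonneg)
    qed (use pochhammer_minus_of_nat_sign block_weight_neg[OF True] in \<open>auto simp: less_imp_le\<close>)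
    finally show ?thesis .
  qed
  then show ?thesis using x by (simp add: EP_SM_mass_def mult.assoc)
qed (simp add: EP_SM_mass_def)

lemma EP_params_bounds: "EP_params \<alpha> \<theta> \<Longrightarrow> \<alpha> \<noteq> 0 \<and> \<theta> > -1"
  by (auto simp: EP_params_def mult_pos_neg) (smt (verit) mult_nonneg_nonpos of_nat_0_le_iff)

lemma pmf_EP_SM:
  assumes "n \<ge> 1" "EP_params \<alpha> \<theta>"
  shows "pmf (EP_SM n \<alpha> \<theta>) x = EP_SM_mass n \<alpha> \<theta> x"
proof -
  have "pmf (embed_pmf (EP_SM_mass n \<alpha> \<theta>)) x = EP_SM_mass n \<alpha> \<theta> x"
  proof (rule pmf_embed_pmf_finite[where A = "count_vectors n"])
    show "sum (EP_SM_mass n \<alpha> \<theta>) (count_vectors n) = 1"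
      using EP_params_bounds[OF assms(2)] assms(1) by (intro sum_EP_SM_mass) auto
  qed (simp_all only: EP_SM_mass_nonneg[OF assms] finite_count_vectors, simp add: EP_SM_mass_def)
  then show ?thesis using assms by (simp add: EP_SM_def)
qed

section \<open>Negative parameter: randomizing the number of types\<close>

text \<open>
  The terms with \<open>m < k\<close> vanish, and shifting the index by \<open>k\<close> leaves the exponential series. This
  is the factorial moment of order \<open>k\<close> of a Poisson law.
\<close>

lemma sums_falling_factorial_exp:
  fixes z :: real
  shows "(\<lambda>m. (- z) ^ m * pochhammer (- real m) k / fact m) sums (z ^ k * exp (- z))"
proof -
  let ?g = "\<lambda>m. (- z) ^ m * pochhammer (- real m) k / fact m"
  have "?g (m + k) = z ^ k * ((- z) ^ m /\<^sub>R fact m)" for m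
  proof -
    have "pochhammer (- real (m + k)) k = (-1) ^ k * (fact (m + k) / fact m)"
      using pochhammer_minus_of_nat[of k "m + k"] by (simp flip: mult.assoc power_add)
        (metis (no_types, lifting) left_minus_one_mult_self mult.commute times_divide_eq_left)
    then have "?g (m + k) = (- z) ^ (m + k) * (-1) ^ k * (fact (m + k) / fact m) / fact (m + k)"
      by (simp only: mult.assoc)
    also have "(- z) ^ (m + k) * (-1) ^ k = z ^ k * (- z) ^ m"
      by (simp add: power_add flip: power_mult_distrib)
    finally show ?thesis by (simp add: field_simps)
  qed
  then have "(\<lambda>m. ?g (m + k)) sums (z ^ k * exp (- z))"
    by (simp only:) (intro sums_mult exp_converges)
  moreover have "(\<Sum>i<k. ?g i) = 0"
    by (intro sum.neutral) (simp add: pochhammer_of_nat_eq_0_lemma)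
  ultimately show ?thesis
    using sums_iff_shift[of ?g k "z ^ k * exp (- z)"] by simp
qed

text \<open>
  The quotient of Gamma values is the denominator \<open>(- m \<alpha>)\<^sub>(\<^sub>n\<^sub>)\<close> of the EP-SM with \<open>\<theta> = - m \<alpha>\<close>.
\<close>

lemma tilde_X_mass_eq:
  assumes "n \<ge> 1" "\<alpha> < 0"
  shows "tilde_X_mass n \<alpha> z m =
    exp z / nb_norm n \<alpha> z * ((- z) ^ m * pochhammer (- real m * \<alpha>) n / fact m)"
proof (cases "m = 0")
  case True
  then show ?thesis using assms by (simp add: tilde_X_mass_def pochhammer_0_left)
next
  case False
  then have "- real m * \<alpha> > 0" using assms by (simp add: mult_pos_neg)
  then have "pochhammer (- real m * \<alpha>) n = Gamma (- real m * \<alpha> + real n) / Gamma (- real m * \<alpha>)"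
    by (intro pochhammer_Gamma) (auto elim!: nonpos_Ints_cases)
  then show ?thesis
    using False assms by (simp add: tilde_X_mass_def nb_norm_from_1 mult_ac)
qed

lemma tilde_X_mass_nonneg:
  assumes "n \<ge> 1" "\<alpha> < 0" "z < 0"
  shows "tilde_X_mass n \<alpha> z m \<ge> 0"
proof -
  have "nb_norm n \<alpha> z > 0" using assms by (intro nb_norm_pos) (simp add: NB_params_def)
  moreover have "pochhammer (- real m * \<alpha>) n \<ge> 0"
    using assms by (cases "m = 0") (auto intro!: pochhammer_nonneg simp: pochhammer_0_left mult_pos_neg)
  ultimately show ?thesis using assms by (simp add: tilde_X_mass_eq)
qed

lemma EP_params_neg: "\<alpha> < 0 \<Longrightarrow> m \<ge> 1 \<Longrightarrow> EP_params \<alpha> (- real m * \<alpha>)"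
  unfolding EP_params_def by blast

text \<open>
  The factor \<open>(- m \<alpha>)\<^sub>(\<^sub>n\<^sub>)\<close> cancels between the two masses, and the remaining dependence on \<open>m\<close> is that of
  the Poisson factorial moment.
\<close>

lemma tilde_X_EP_SM_mass_sums:
  assumes n: "n \<ge> 1" and \<alpha>: "\<alpha> < 0" and z: "z < 0"
  shows "(\<lambda>m. tilde_X_mass n \<alpha> z m * EP_SM_mass n \<alpha> (- real m * \<alpha>) x)
           sums NB_CPSM_mass n \<alpha> z x"
proof (cases "x \<in> count_vectors n")
  case x: True
  let ?k = "\<Sum>i=1..n. x i"
  let ?W = "\<Prod>i=1..n. block_weight \<alpha> i ^ x i / fact (x i)"
  have k: "?k \<ge> 1" using block_number_pos[OF x n] .
  have term_eq: "tilde_X_mass n \<alpha> z m * EP_SM_mass n \<alpha> (- real m * \<alpha>) x =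
    fact n * ?W * exp z / nb_norm n \<alpha> z * ((- z) ^ m * pochhammer (- real m) ?k / fact m)" for m
  proof (cases "m = 0")
    case True
    then have "pochhammer (- real m) ?k = 0"
      using k by (intro pochhammer_of_nat_eq_0_lemma) simp
    then show ?thesis using True by (simp add: tilde_X_mass_def)
  next
    case False
    have pos: "- real m * \<alpha> > 0" using False \<alpha> by (simp add: mult_pos_neg)
    then have p: "pochhammer (- real m * \<alpha>) n > 0" by (rule pochhammer_pos)
    have "EP_ratio n \<alpha> (- real m * \<alpha>) ?k = pochhammer (- real m) ?k / pochhammer (- real m * \<alpha>) n"
      using pos \<alpha> by (auto simp: EP_ratio_def)
    then show ?thesis
      using x p unfolding EP_SM_mass_def tilde_X_mass_eq[OF n \<alpha>] by simp
  qed
  have "(\<lambda>m. tilde_X_mass n \<alpha> z m * EP_SM_mass n \<alpha> (- real m * \<alpha>) x) sums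
    (fact n * ?W * exp z / nb_norm n \<alpha> z * (z ^ ?k * exp (- z)))"
    unfolding term_eq by (intro sums_mult sums_falling_factorial_exp)
  also have "fact n * ?W * exp z / nb_norm n \<alpha> z * (z ^ ?k * exp (- z)) = NB_CPSM_mass n \<alpha> z x"
    unfolding NB_CPSM_mass_eq[OF x] by (simp add: exp_minus)
  finally show ?thesis .
qed (simp add: EP_SM_mass_def NB_CPSM_mass_def)

text \<open>
  No separate computation is needed: summing \<open>tilde_X_EP_SM_mass_sums\<close> over the finitely many
  vectors \<open>x\<close> turns the EP-SM masses on the left and the NB-CPSM masses on the right into 1.
\<close>

lemma tilde_X_mass_sums:
  assumes n: "n \<ge> 1" and \<alpha>: "\<alpha> < 0" and z: "z < 0"
  shows "tilde_X_mass n \<alpha> z sums 1"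
proof -
  have "(\<lambda>m. \<Sum>x\<in>count_vectors n. tilde_X_mass n \<alpha> z m * EP_SM_mass n \<alpha> (- real m * \<alpha>) x)
          sums (\<Sum>x\<in>count_vectors n. NB_CPSM_mass n \<alpha> z x)"
    using assms by (intro sums_sum tilde_X_EP_SM_mass_sums)
  also have "(\<Sum>x\<in>count_vectors n. NB_CPSM_mass n \<alpha> z x) = 1"
    using assms by (intro sum_NB_CPSM_mass) (simp add: NB_params_def)
  also have "(\<lambda>m. \<Sum>x\<in>count_vectors n. tilde_X_mass n \<alpha> z m * EP_SM_mass n \<alpha> (- real m * \<alpha>) x)
     = tilde_X_mass n \<alpha> z"
  proof
    fix m
    show "(\<Sum>x\<in>count_vectors n. tilde_X_mass n \<alpha> z m * EP_SM_mass n \<alpha> (- real m * \<alpha>) x)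
       = tilde_X_mass n \<alpha> z m"
    proof (cases "m \<ge> 1")
      case True
      then have "(\<Sum>x\<in>count_vectors n. EP_SM_mass n \<alpha> (- real m * \<alpha>) x) = 1"
        using EP_params_bounds[OF EP_params_neg[OF \<alpha>]] n by (intro sum_EP_SM_mass) auto
      then show ?thesis by (simp flip: sum_distrib_left)
    qed (simp add: tilde_X_mass_def)
  qed
  finally show ?thesis .
qed

lemma pmf_tilde_X_law:
  assumes "n \<ge> 1" "\<alpha> < 0" "z < 0"
  shows "pmf (tilde_X_law n \<alpha> z) m = tilde_X_mass n \<alpha> z m"
  unfolding tilde_X_law_def
proof (rule pmf_embed_pmf)
  have "(\<Sum>m. ennreal (tilde_X_mass n \<alpha> z m)) = ennreal 1"
    by (rule suminf_ennreal_eq[OF tilde_X_mass_nonneg tilde_X_mass_sums]) (fact assms)+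
  then show "(\<integral>\<^sup>+m. ennreal (tilde_X_mass n \<alpha> z m) \<partial>count_space UNIV) = 1"
    by (simp add: nn_integral_count_space_nat)
qed (rule tilde_X_mass_nonneg[OF assms])

theorem NB_CPSM_eq_EP_SM_mixture:
  assumes n: "n \<ge> 1" and \<alpha>: "\<alpha> < 0" and z: "z < 0"
  shows "NB_CPSM n \<alpha> z = bind_pmf (tilde_X_law n \<alpha> z) (\<lambda>m. EP_SM n \<alpha> (- real m * \<alpha>))"
proof (rule pmf_eqI)
  fix x
  have par: "NB_params \<alpha> z" using \<alpha> z by (simp add: NB_params_def)
  have "ennreal (pmf (bind_pmf (tilde_X_law n \<alpha> z) (\<lambda>m. EP_SM n \<alpha> (- real m * \<alpha>))) x)
     = (\<Sum>m. ennreal (pmf (tilde_X_law n \<alpha> z) m) * ennreal (pmf (EP_SM n \<alpha> (- real m * \<alpha>)) x))"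
    by (simp only: ennreal_pmf_bind nn_integral_measure_pmf nn_integral_count_space_nat)
  also have "\<dots> = (\<Sum>m. ennreal (tilde_X_mass n \<alpha> z m * EP_SM_mass n \<alpha> (- real m * \<alpha>) x))"
  proof (intro suminf_cong)
    fix m
    show "ennreal (pmf (tilde_X_law n \<alpha> z) m) * ennreal (pmf (EP_SM n \<alpha> (- real m * \<alpha>)) x)
      = ennreal (tilde_X_mass n \<alpha> z m * EP_SM_mass n \<alpha> (- real m * \<alpha>) x)"
    proof (cases "m \<ge> 1")
      case True
      note par' = EP_params_neg[OF \<alpha> True]
      show ?thesis
        unfolding pmf_EP_SM[OF n par'] pmf_tilde_X_law[OF assms]
        by (rule ennreal_mult[symmetric])
           (simp_all only: tilde_X_mass_nonneg[OF assms] EP_SM_mass_nonneg[OF n par'])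
    next
      case False
      then show ?thesis by (simp add: pmf_tilde_X_law[OF assms] tilde_X_mass_def)
    qed
  qed
  also have "\<dots> = ennreal (NB_CPSM_mass n \<alpha> z x)"
  proof (rule suminf_ennreal_eq[OF _ tilde_X_EP_SM_mass_sums[OF assms]])
    show "0 \<le> tilde_X_mass n \<alpha> z m * EP_SM_mass n \<alpha> (- real m * \<alpha>) x" for m
    proof (cases "m \<ge> 1")
      case True
      then show ?thesis
        by (intro mult_nonneg_nonneg tilde_X_mass_nonneg[OF assms] EP_SM_mass_nonneg[OF n]
            EP_params_neg[OF \<alpha>])
    qed (simp add: tilde_X_mass_def)
  qed
  finally show "pmf (NB_CPSM n \<alpha> z) x =
      pmf (bind_pmf (tilde_X_law n \<alpha> z) (\<lambda>m. EP_SM n \<alpha> (- real m * \<alpha>))) x"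
    by (simp add: pmf_NB_CPSM[OF par] NB_CPSM_mass_nonneg[OF par])
qed

section \<open>Power substitution on the positive half-line\<close>

text \<open>
  Substitution on compact intervals, exhausted by \<open>[- k, k]\<close> and its image. The integrals are
  written as measures of sets under densities, so that continuity from below gives the limit.
\<close>

lemma nn_integral_exp_substitution:
  fixes f :: "real \<Rightarrow> ennreal"
  assumes [measurable]: "f \<in> borel_measurable borel"
  shows "(\<integral>\<^sup>+s. f s * indicator {0<..} s \<partial>lborel) = (\<integral>\<^sup>+v. f (exp v) * ennreal (exp v) \<partial>lborel)"
proof -
  let ?A = "\<lambda>k::nat. {exp (- real k)..exp (real k)}"
  let ?B = "\<lambda>k::nat. {- real k..real k}"
  let ?M = "density lborel f"
  let ?N = "density lborel (\<lambda>v. f (exp v) * ennreal (exp v))"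
  have eq: "emeasure ?M (?A k) = emeasure ?N (?B k)" if "k \<ge> 1" for k
    using that nn_integral_substitution_aux[of f "- real k" "real k" exp exp]
    by (simp add: emeasure_density DERIV_exp continuous_on_exp)
  have "(\<lambda>k. emeasure ?M (?A k)) \<longlonglongrightarrow> emeasure ?M (\<Union>k. ?A k)"
    by (rule Lim_emeasure_incseq) (auto simp: incseq_def)
  moreover have "(\<Union>k. ?A k) = {0<..}"
  proof (intro antisym subsetI)
    fix s :: real assume "s \<in> {0<..}"
    then have s: "s > 0" by simp
    obtain k :: nat where "real k \<ge> \<bar>ln s\<bar>" using real_arch_simple by blast
    then have "s \<in> ?A k" using s by (auto simp: ln_ge_iff[symmetric] exp_le_cancel_iff[symmetric, of "ln s"] simp del: exp_le_cancel_iff)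
       (smt (verit) exp_le_cancel_iff exp_ln)+
    then show "s \<in> (\<Union>k. ?A k)" by blast
  next
    fix s assume "s \<in> (\<Union>k. ?A k)"
    then show "s \<in> {0<..}" using less_le_trans[OF exp_gt_zero] by auto
  qed
  ultimately have M: "(\<lambda>k. emeasure ?M (?A k)) \<longlonglongrightarrow> emeasure ?M {0<..}" by simp
  have "(\<lambda>k. emeasure ?N (?B k)) \<longlonglongrightarrow> emeasure ?N (\<Union>k. ?B k)"
    by (rule Lim_emeasure_incseq) (auto simp: incseq_def)
  moreover have "(\<Union>k. ?B k) = UNIV"
  proof (intro antisym subsetI UNIV_I)
    fix v :: real
    obtain k :: nat where "real k \<ge> \<bar>v\<bar>" using real_arch_simple by blast
    then have "v \<in> ?B k" by auto
    then show "v \<in> (\<Union>k. ?B k)" by blast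
  qed
  ultimately have N: "(\<lambda>k. emeasure ?N (?B k)) \<longlonglongrightarrow> emeasure ?N UNIV" by simp
  have "(\<lambda>k. emeasure ?M (?A k)) \<longlonglongrightarrow> emeasure ?N UNIV"
    by (rule Lim_transform_eventually[OF N])
       (auto simp: eventually_sequentially eq intro!: exI[of _ 1])
  with M have "emeasure ?M {0<..} = emeasure ?N UNIV" by (rule LIMSEQ_unique)
  then show ?thesis by (simp add: emeasure_density)
qed

text \<open>
  In logarithmic coordinates a power map is a linear scaling, so that decreasing powers
  (\<open>p < 0\<close>) need no separate treatment.
\<close>

lemma nn_integral_powr_substitution:
  fixes f :: "real \<Rightarrow> ennreal" and p :: real
  assumes [measurable]: "f \<in> borel_measurable borel" and p: "p \<noteq> 0"
  shows "(\<integral>\<^sup>+s. f s * indicator {0<..} s \<partial>lborel) =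
    (\<integral>\<^sup>+t. f (t powr p) * ennreal (\<bar>p\<bar> * t powr (p - 1)) * indicator {0<..} t \<partial>lborel)"
proof -
  have "(\<integral>\<^sup>+s. f s * indicator {0<..} s \<partial>lborel) = (\<integral>\<^sup>+v. f (exp v) * ennreal (exp v) \<partial>lborel)"
    by (rule nn_integral_exp_substitution) measurable
  also have "\<dots> = ennreal \<bar>p\<bar> * (\<integral>\<^sup>+v. f (exp (p * v)) * ennreal (exp (p * v)) \<partial>lborel)"
    by (subst nn_integral_real_affine[OF _ p, of _ 0]) simp_all
  also have "\<dots> = (\<integral>\<^sup>+v. ennreal \<bar>p\<bar> * (f (exp (p * v)) * ennreal (exp (p * v))) \<partial>lborel)"
    by (rule nn_integral_cmult[symmetric]) measurable
  also have "\<dots> = (\<integral>\<^sup>+v. f (exp v powr p) * ennreal (\<bar>p\<bar> * exp v powr (p - 1)) * ennreal (exp v) \<partial>lborel)"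
  proof (rule nn_integral_cong)
    fix v :: real
    have "exp (p * v) = exp v powr (p - 1) * exp v"
      by (simp add: powr_def algebra_simps flip: exp_add)
    moreover have "exp v powr p = exp (p * v)" by (simp add: powr_def)
    ultimately show "ennreal \<bar>p\<bar> * (f (exp (p * v)) * ennreal (exp (p * v))) =
        f (exp v powr p) * ennreal (\<bar>p\<bar> * exp v powr (p - 1)) * ennreal (exp v)"
      by (simp add: ennreal_mult mult_ac)
  qed
  also have "\<dots> = (\<integral>\<^sup>+t. f (t powr p) * ennreal (\<bar>p\<bar> * t powr (p - 1)) * indicator {0<..} t \<partial>lborel)"
    by (rule nn_integral_exp_substitution[symmetric]) measurable
  finally show ?thesis .
qed

section \<open>Exponentially tilted moments of a positive stable variable\<close>

text \<open>
  A single term of the exponential series is at most its sum.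
\<close>

lemma power_exp_bound:
  fixes x y :: real
  assumes "x \<ge> 0" "y > 0"
  shows "x ^ n * exp (- y * x) \<le> fact n / y ^ n"
proof -
  have s: "summable (\<lambda>k. inverse (fact k) * (y * x) ^ k)"
    using summable_exp[of "y * x"] .
  have "inverse (fact n) * (y * x) ^ n \<le> (\<Sum>k. inverse (fact k) * (y * x) ^ k)"
    using sum_le_suminf[OF s, of "{n}"] assms by simp
  also have "\<dots> = exp (y * x)" by (simp add: exp_def)
  finally have "(y * x) ^ n \<le> fact n * exp (y * x)" by (simp add: field_simps)
  then have "x ^ n * y ^ n \<le> fact n * exp (y * x)" by (simp add: power_mult_distrib mult.commute)
  then show ?thesis using assms by (simp add: exp_minus field_simps)
qed

lemma exp_diff_bound:
  fixes a b c x :: real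
  assumes "x \<ge> 0" "a \<ge> c" "b \<ge> c"
  shows "\<bar>exp (- a * x) - exp (- b * x)\<bar> \<le> x * exp (- c * x) * \<bar>a - b\<bar>"
proof -
  have "norm (exp (- a * x) - exp (- b * x)) \<le> x * exp (- c * x) * norm (a - b)"
  proof (rule field_differentiable_bound[where S = "{c..}" and f' = "\<lambda>v. - x * exp (- v * x)"])
    fix v assume "v \<in> {c..}"
    then show "norm (- x * exp (- v * x)) \<le> x * exp (- c * x)"
      using assms by (auto simp: abs_mult intro!: mult_left_mono mult_right_mono)
  qed (use assms in \<open>auto intro!: derivative_eq_intros\<close>)
  then show ?thesis by simp
qed

text \<open>
  An almost surely positive random variable. Positivity alone makes all exponentially
  tilted moments finite, even when the variable itself is not integrable, as for a stable law.
\<close>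

locale positive_variable = prob_space M for M :: "'a measure" +
  fixes X :: "'a \<Rightarrow> real"
  assumes meas [measurable]: "X \<in> borel_measurable M" and pos: "AE \<omega> in M. X \<omega> > 0"
begin

definition tilted_moment :: "nat \<Rightarrow> real \<Rightarrow> real" where
  "tilted_moment n y = (\<integral>\<omega>. X \<omega> ^ n * exp (- y * X \<omega>) \<partial>M)"

lemma integrable_tilted_moment:
  assumes "y > 0"
  shows "integrable M (\<lambda>\<omega>. X \<omega> ^ n * exp (- y * X \<omega>))"
proof (rule integrable_const_bound[where B = "fact n / y ^ n"])
  show "AE \<omega> in M. norm (X \<omega> ^ n * exp (- y * X \<omega>)) \<le> fact n / y ^ n"
    using pos
  proof eventually_elim
    case (elim \<omega>)
    then show ?case using power_exp_bound[of "X \<omega>" y n] assms by simp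
  qed
qed measurable

text \<open>
  Differentiation under the integral sign. For \<open>v\<close> above \<open>y / 2\<close> the difference quotients of
  \<open>X\<^sup>n exp (- v X)\<close> are dominated by \<open>X\<^sup>n\<^sup>+\<^sup>1 exp (- y X / 2)\<close>, the integrand of a tilted moment at
  \<open>y / 2\<close>.
\<close>

lemma DERIV_tilted_moment:
  assumes y: "y > 0"
  shows "(tilted_moment n has_real_derivative - tilted_moment (Suc n) y) (at y)"
proof -
  define c where "c = y / 2"
  have c: "0 < c" "c < y" using y by (auto simp: c_def)
  have "((\<lambda>v. (tilted_moment n v - tilted_moment n y) / (v - y)) \<longlongrightarrow> - tilted_moment (Suc n) y)
          (at y within {c<..})"
    unfolding tendsto_at_iff_sequentially
  proof (intro allI impI)
    fix V :: "nat \<Rightarrow> real"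
    assume V: "\<forall>i. V i \<in> {c<..} - {y}" and lim: "V \<longlonglongrightarrow> y"
    let ?q = "\<lambda>i \<omega>. X \<omega> ^ n * ((exp (- V i * X \<omega>) - exp (- y * X \<omega>)) / (V i - y))"
    have "(\<lambda>i. \<integral>\<omega>. ?q i \<omega> \<partial>M) \<longlonglongrightarrow> (\<integral>\<omega>. - (X \<omega> ^ Suc n * exp (- y * X \<omega>)) \<partial>M)"
    proof (rule integral_dominated_convergence)
      show "integrable M (\<lambda>\<omega>. X \<omega> ^ Suc n * exp (- c * X \<omega>))"
        by (rule integrable_tilted_moment) (rule c)
      show "AE \<omega> in M. (\<lambda>i. ?q i \<omega>) \<longlonglongrightarrow> - (X \<omega> ^ Suc n * exp (- y * X \<omega>))"
      proof (rule AE_I2)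
        fix \<omega>
        have "((\<lambda>v. exp (- v * X \<omega>)) has_real_derivative - X \<omega> * exp (- y * X \<omega>)) (at y)"
          by (auto intro!: derivative_eq_intros)
        then have "((\<lambda>v. (exp (- v * X \<omega>) - exp (- y * X \<omega>)) / (v - y)) \<longlongrightarrow>
            - X \<omega> * exp (- y * X \<omega>)) (at y)"
          by (simp add: has_field_derivative_iff)
        then have "(\<lambda>i. (exp (- V i * X \<omega>) - exp (- y * X \<omega>)) / (V i - y)) \<longlonglongrightarrow>
            - X \<omega> * exp (- y * X \<omega>)"
          using V lim unfolding tendsto_at_iff_sequentially comp_def by blast
        then have "(\<lambda>i. ?q i \<omega>) \<longlonglongrightarrow> X \<omega> ^ n * (- X \<omega> * exp (- y * X \<omega>))"
          by (rule tendsto_mult_left)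
        then show "(\<lambda>i. ?q i \<omega>) \<longlonglongrightarrow> - (X \<omega> ^ Suc n * exp (- y * X \<omega>))"
          by (simp add: mult_ac)
      qed
      show "AE \<omega> in M. norm (?q i \<omega>) \<le> X \<omega> ^ Suc n * exp (- c * X \<omega>)" for i
        using pos
      proof eventually_elim
        case (elim \<omega>)
        have d: "\<bar>V i - y\<bar> > 0" using V by auto
        have "V i \<ge> c" using V by (auto intro: less_imp_le)
        then have "\<bar>exp (- V i * X \<omega>) - exp (- y * X \<omega>)\<bar> / \<bar>V i - y\<bar> \<le> X \<omega> * exp (- c * X \<omega>)"
          using exp_diff_bound[of "X \<omega>" c "V i" y] elim c d by (simp add: pos_divide_le_eq)
        then have "X \<omega> ^ n * (\<bar>exp (- V i * X \<omega>) - exp (- y * X \<omega>)\<bar> / \<bar>V i - y\<bar>)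
            \<le> X \<omega> ^ n * (X \<omega> * exp (- c * X \<omega>))"
          using elim by (intro mult_left_mono) auto
        then show ?case using elim by (simp add: abs_mult mult_ac)
      qed
    qed measurable
    moreover have "(\<integral>\<omega>. ?q i \<omega> \<partial>M) = (tilted_moment n (V i) - tilted_moment n y) / (V i - y)" for i
    proof -
      have Vi: "V i > 0" using V c by (auto intro: less_trans)
      have "(\<integral>\<omega>. ?q i \<omega> \<partial>M) =
          (\<integral>\<omega>. (X \<omega> ^ n * exp (- V i * X \<omega>) - X \<omega> ^ n * exp (- y * X \<omega>)) / (V i - y) \<partial>M)"
        by (simp add: right_diff_distrib)
      also have "\<dots> = (\<integral>\<omega>. X \<omega> ^ n * exp (- V i * X \<omega>) - X \<omega> ^ n * exp (- y * X \<omega>) \<partial>M) / (V i - y)"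
        by (rule integral_divide_zero)
      finally show ?thesis
        unfolding tilted_moment_def
        by (simp only: Bochner_Integration.integral_diff[OF integrable_tilted_moment[OF Vi]
              integrable_tilted_moment[OF y]])
    qed
    ultimately show "((\<lambda>v. (tilted_moment n v - tilted_moment n y) / (v - y)) \<circ> V)
        \<longlonglongrightarrow> - tilted_moment (Suc n) y"
      by (simp only: comp_def Bochner_Integration.integral_minus tilted_moment_def[symmetric])
  qed
  moreover have "at y within {c<..} = at y" using c by (intro at_within_open) auto
  ultimately show ?thesis by (simp add: has_field_derivative_iff)
qed

text \<open>
  Each differentiation of \<open>exp (- y\<^sup>\<alpha>) y powr (k \<alpha> - n)\<close> produces the exponents \<open>k \<alpha> - (n + 1)\<close> and
  \<open>(k + 1) \<alpha> - (n + 1)\<close> with the factors \<open>k \<alpha> - n\<close> and \<open>- \<alpha>\<close>, and these are the factors of the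
  triangular recurrence for the generalized factorial coefficients, up to the sign between
  the derivative of a tilted moment and the next moment.
\<close>

lemma tilted_moment_stable:
  assumes laplace: "\<And>t. t > 0 \<Longrightarrow> (\<integral>\<omega>. exp (- t * X \<omega>) \<partial>M) = exp (- (t powr \<alpha>))"
    and y: "y > 0"
  shows "tilted_moment n y = exp (- (y powr \<alpha>)) *
    (\<Sum>k=0..n. gen_fact_coeff n k \<alpha> * y powr (real k * \<alpha> - real n))"
  using y
proof (induction n arbitrary: y)
  case 0
  then show ?case using laplace[of y] by (simp add: tilted_moment_def gen_fact_coeff_0)
next
  case (Suc n)
  note y = \<open>y > 0\<close>
  let ?E = "\<lambda>v. exp (- (v powr \<alpha>))"
  let ?q = "\<lambda>k. y powr (real k * \<alpha> - real (Suc n))"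
  have d1: "(?E has_real_derivative - (\<alpha> * y powr (\<alpha> - 1)) * ?E y) (at y)"
    using y by (auto intro!: derivative_eq_intros)
  have d2: "((\<lambda>v. v powr (real k * \<alpha> - real n)) has_real_derivative
      (real k * \<alpha> - real n) * ?q k) (at y)" for k
    using y by (auto intro!: derivative_eq_intros simp: algebra_simps)
  have "((\<lambda>v. ?E v * (\<Sum>k=0..n. gen_fact_coeff n k \<alpha> * v powr (real k * \<alpha> - real n)))
     has_real_derivative (- (\<alpha> * y powr (\<alpha> - 1)) * ?E y) *
        (\<Sum>k=0..n. gen_fact_coeff n k \<alpha> * y powr (real k * \<alpha> - real n)) +
        (\<Sum>k=0..n. gen_fact_coeff n k \<alpha> * ((real k * \<alpha> - real n) * ?q k)) * ?E y) (at y)"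
    by (intro DERIV_mult d1 DERIV_sum DERIV_cmult d2)
  moreover have "(\<forall>\<^sub>F v in nhds y. ?E v * (\<Sum>k=0..n. gen_fact_coeff n k \<alpha> * v powr (real k * \<alpha> - real n))
      = tilted_moment n v)"
    using eventually_nhds_in_open[of "{0<..}" y] y Suc.IH by (auto elim!: eventually_mono)
  ultimately have "(tilted_moment n has_real_derivative (- (\<alpha> * y powr (\<alpha> - 1)) * ?E y) *
        (\<Sum>k=0..n. gen_fact_coeff n k \<alpha> * y powr (real k * \<alpha> - real n)) +
        (\<Sum>k=0..n. gen_fact_coeff n k \<alpha> * ((real k * \<alpha> - real n) * ?q k)) * ?E y) (at y)"
    by (subst (asm) DERIV_cong_ev[OF refl _ refl])
  from DERIV_unique[OF this DERIV_tilted_moment[OF y]]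
  have "tilted_moment (Suc n) y = ?E y * (\<Sum>k=0..n. gen_fact_coeff n k \<alpha> *
      (\<alpha> * (y powr (\<alpha> - 1) * y powr (real k * \<alpha> - real n)) + (real n - real k * \<alpha>) * ?q k))"
    by (simp add: algebra_simps sum.distrib sum_subtractf sum_negf sum_distrib_left sum_distrib_right)
  also have "\<dots> = ?E y * (\<Sum>k=0..n. gen_fact_coeff n k \<alpha> *
      ((real n - real k * \<alpha>) * ?q k + \<alpha> * ?q (Suc k)))"
  proof -
    have "y powr (\<alpha> - 1) * y powr (real k * \<alpha> - real n) = ?q (Suc k)" for k
      by (simp add: algebra_simps flip: powr_add)
    then show ?thesis by (simp only: add.commute)
  qed
  also have "\<dots> = ?E y * (\<Sum>k=0..Suc n. gen_fact_coeff (Suc n) k \<alpha> * ?q k)"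
    by (simp only: sum_gen_fact_coeff_Suc)
  finally show ?case .
qed

end

section \<open>Parameter in the unit interval: randomizing z\<close>

lemma distributed_lborel_density:
  assumes "distributed M lborel X f"
  shows "distr M borel X = density lborel f" "X \<in> borel_measurable M" "f \<in> borel_measurable borel"
proof -
  have "distr M borel X = distr M lborel X" by (rule distr_cong) simp_all
  then show "distr M borel X = density lborel f" using assms by (simp add: distributed_def)
qed (use assms in \<open>auto simp: distributed_def\<close>)

lemma (in prob_space) nn_integral_indep_densities:
  fixes X Y :: "'a \<Rightarrow> real" and h :: "real \<Rightarrow> real \<Rightarrow> ennreal"
  assumes ind: "indep_var borel X borel Y"
    and X: "distributed M lborel X f" and Y: "distributed M lborel Y g"
    and h: "case_prod h \<in> borel_measurable (borel \<Otimes>\<^sub>M borel)"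
  shows "(\<integral>\<^sup>+\<omega>. h (X \<omega>) (Y \<omega>) \<partial>M) = (\<integral>\<^sup>+y. g y * (\<integral>\<^sup>+x. f x * h x y \<partial>lborel) \<partial>lborel)"
proof -
  note [measurable] = h distributed_lborel_density(2,3)[OF X] distributed_lborel_density(2,3)[OF Y]
  interpret X: prob_space "distr M borel X" by (rule prob_space_distr) measurable
  interpret Y: prob_space "distr M borel Y" by (rule prob_space_distr) measurable
  interpret XY: pair_sigma_finite "distr M borel X" "distr M borel Y" ..
  have "(\<integral>\<^sup>+\<omega>. h (X \<omega>) (Y \<omega>) \<partial>M) = (\<integral>\<^sup>+p. case_prod h p \<partial>distr M (borel \<Otimes>\<^sub>M borel) (\<lambda>\<omega>. (X \<omega>, Y \<omega>)))"
    by (subst nn_integral_distr) auto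
  also have "\<dots> = (\<integral>\<^sup>+p. case_prod h p \<partial>(distr M borel X \<Otimes>\<^sub>M distr M borel Y))"
    using ind unfolding indep_var_distribution_eq by simp
  also have "\<dots> = (\<integral>\<^sup>+y. \<integral>\<^sup>+x. h x y \<partial>distr M borel X \<partial>distr M borel Y)"
    by (subst XY.nn_integral_snd[symmetric]) simp_all
  also have "\<dots> = (\<integral>\<^sup>+y. g y * (\<integral>\<^sup>+x. f x * h x y \<partial>lborel) \<partial>lborel)"
    unfolding distributed_lborel_density(1)[OF X] distributed_lborel_density(1)[OF Y]
    by (subst nn_integral_density; (simp add: nn_integral_density)?)
  finally show ?thesis .
qed

text \<open>
  The density \<open>f\<close> may be nonzero on a null set of nonpositive arguments, hence the indicator, which is
  harmless because \<open>X\<close> is almost surely positive.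
\<close>

lemma nn_integral_tilted_moment:
  assumes st: "positive_stable R \<alpha> X" and X: "distributed R lborel X (\<lambda>x. ennreal (f x))"
    and nonneg: "\<And>x. f x \<ge> 0" and y: "y > 0"
  shows "(\<integral>\<^sup>+t. ennreal (t ^ n * exp (- y * t) * f t) * indicator {0<..} t \<partial>lborel) =
     ennreal (exp (- (y powr \<alpha>)) * y powr (- real n) * nb_norm n \<alpha> (y powr \<alpha>))"
proof -
  interpret positive_variable R X
    using st by (simp add: positive_stable_def positive_variable_def positive_variable_axioms_def)
  have "(\<integral>\<^sup>+t. ennreal (t ^ n * exp (- y * t) * f t) * indicator {0<..} t \<partial>lborel) =
      (\<integral>\<^sup>+t. ennreal (f t) * (ennreal (t ^ n * exp (- y * t)) * indicator {0<..} t) \<partial>lborel)"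
    using nonneg by (intro nn_integral_cong) (auto simp: ennreal_mult mult_ac split: split_indicator)
  also have "\<dots> = (\<integral>\<^sup>+\<omega>. ennreal (X \<omega> ^ n * exp (- y * X \<omega>)) * indicator {0<..} (X \<omega>) \<partial>R)"
    by (rule distributed_nn_integral[OF X]) measurable
  also have "\<dots> = (\<integral>\<^sup>+\<omega>. ennreal (X \<omega> ^ n * exp (- y * X \<omega>)) \<partial>R)"
    using pos by (intro nn_integral_cong_AE) (auto elim!: eventually_mono)
  also have "\<dots> = ennreal (tilted_moment n y)"
    unfolding tilted_moment_def
    using pos by (intro nn_integral_eq_integral integrable_tilted_moment y)
      (auto elim!: eventually_mono)
  also have "tilted_moment n y = exp (- (y powr \<alpha>)) *
    (\<Sum>k=0..n. gen_fact_coeff n k \<alpha> * y powr (real k * \<alpha> - real n))"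
    using st y by (intro tilted_moment_stable) (auto simp: positive_stable_def)
  also have "(\<Sum>k=0..n. gen_fact_coeff n k \<alpha> * y powr (real k * \<alpha> - real n)) =
      y powr (- real n) * nb_norm n \<alpha> (y powr \<alpha>)"
    unfolding nb_norm_def sum_distrib_left
  proof (intro sum.cong refl)
    fix k
    have "y powr (real k * \<alpha> - real n) = y powr (- real n) * (y powr \<alpha>) ^ k"
      using y by (simp add: powr_powr mult.commute flip: powr_realpow powr_add)
    then show "gen_fact_coeff n k \<alpha> * y powr (real k * \<alpha> - real n) =
      y powr (- real n) * (gen_fact_coeff n k \<alpha> * (y powr \<alpha>) ^ k)"
      by simp
  qed
  finally show ?thesis by (simp add: mult.assoc)
qed

definition Xbar_density :: "nat \<Rightarrow> real \<Rightarrow> real \<Rightarrow> real \<Rightarrow> real" where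
  "Xbar_density n \<alpha> \<theta> z =
     (if z > 0
      then Gamma (\<theta> + 1) / (\<alpha> * Gamma (\<theta> / \<alpha> + 1) * Gamma (\<theta> + real n)) *
           z powr (\<theta> / \<alpha> - 1) * exp (- z) * nb_norm n \<alpha> z
      else 0)"

text \<open>
  The substitution \<open>s = t\<^sup>-\<^sup>\<alpha>\<close>, with its Jacobian, turns the density of \<open>S\<close> into the stable density
  tilted by \<open>t\<^sup>-\<^sup>\<theta>\<close>.
\<close>

lemma S_density_powr:
  assumes \<alpha>: "0 < \<alpha>" and t: "t > 0"
  shows "S_density f \<alpha> \<theta> (t powr (- \<alpha>)) * (\<alpha> * t powr (- \<alpha> - 1)) =
    Gamma (\<theta> + 1) / Gamma (\<theta> / \<alpha> + 1) * (t powr (- \<theta>) * f t)"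
proof -
  have "(t powr (- \<alpha>)) powr (- 1 / \<alpha>) = t"
    using \<alpha> t by (simp add: powr_powr)
  moreover have "(t powr (- \<alpha>)) powr ((\<theta> - 1) / \<alpha> - 1) * t powr (- \<alpha> - 1) = t powr (- \<theta>)"
  proof -
    have "- \<alpha> * ((\<theta> - 1) / \<alpha> - 1) + (- \<alpha> - 1) = - \<theta>"
      using \<alpha> by (simp add: field_simps)
    then show ?thesis by (simp only: powr_powr flip: powr_add)
  qed
  ultimately show ?thesis using \<alpha> t by (simp add: S_density_def mult_ac)
qed

text \<open>
  The substitution \<open>g = t y\<close>, under which \<open>g\<^sup>\<alpha> t\<^sup>-\<^sup>\<alpha> = y\<^sup>\<alpha>\<close>.
\<close>

lemma gamma_density_scale:
  assumes \<alpha>: "0 < \<alpha>" and t: "t > 0" and [measurable]: "H \<in> borel_measurable borel"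
  shows "(\<integral>\<^sup>+g. ennreal (gamma_density a g) * H (g powr \<alpha> * t powr (- \<alpha>)) \<partial>lborel) =
    (\<integral>\<^sup>+y. ennreal (t powr a * y powr (a - 1) * exp (- y * t) / Gamma a) * H (y powr \<alpha>)
         * indicator {0<..} y \<partial>lborel)"
proof -
  have [measurable]: "gamma_density a \<in> borel_measurable borel"
    unfolding gamma_density_def by measurable
  have "(\<integral>\<^sup>+g. ennreal (gamma_density a g) * H (g powr \<alpha> * t powr (- \<alpha>)) \<partial>lborel) =
    ennreal \<bar>t\<bar> * (\<integral>\<^sup>+y. ennreal (gamma_density a (0 + t * y)) * H ((0 + t * y) powr \<alpha> * t powr (- \<alpha>)) \<partial>lborel)"
    using t by (intro nn_integral_real_affine) auto
  also have "\<dots> = (\<integral>\<^sup>+y. ennreal t * (ennreal (gamma_density a (t * y)) * H ((t * y) powr \<alpha> * t powr (- \<alpha>))) \<partial>lborel)"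
    using t by (simp add: nn_integral_cmult)
  also have "\<dots> = (\<integral>\<^sup>+y. ennreal (t powr a * y powr (a - 1) * exp (- y * t) / Gamma a) * H (y powr \<alpha>)
         * indicator {0<..} y \<partial>lborel)"
  proof (rule nn_integral_cong)
    fix y :: real
    show "ennreal t * (ennreal (gamma_density a (t * y)) * H ((t * y) powr \<alpha> * t powr (- \<alpha>))) =
      ennreal (t powr a * y powr (a - 1) * exp (- y * t) / Gamma a) * H (y powr \<alpha>) * indicator {0<..} y"
    proof (cases "y > 0")
      case True
      have "(t * y) powr \<alpha> * t powr (- \<alpha>) = y powr \<alpha>"
        using t True by (simp add: powr_mult powr_minus)
      moreover have "t * gamma_density a (t * y) = t powr a * y powr (a - 1) * exp (- y * t) / Gamma a"
        using t True by (simp add: gamma_density_def powr_mult powr_diff mult_ac)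
      ultimately show ?thesis
        using True t by (simp only: ennreal_mult'[symmetric] mult.assoc[symmetric] less_imp_le)
           (simp add: mult.assoc[symmetric] ennreal_mult'[symmetric])
    next
      case False
      then show ?thesis using t by (simp add: gamma_density_def zero_less_mult_iff)
    qed
  qed
  finally show ?thesis .
qed

text \<open>
  The law of \<open>G\<^sup>\<alpha> S\<close>. In the coordinates \<open>s = t\<^sup>-\<^sup>\<alpha>\<close>, \<open>g = t y\<close> the powers of \<open>t\<close> combine to
  \<open>t\<^sup>-\<^sup>\<theta> t\<^sup>\<theta>\<^sup>+\<^sup>n = t\<^sup>n\<close> while the value of the product depends on \<open>y\<close> only. Integrating over \<open>t\<close> first
  therefore gives the \<open>n\<close>-th tilted moment of the stable law at \<open>y\<close>, that is, the polynomial
  \<open>S\<^sub>n(y\<^sup>\<alpha>)\<close>.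
\<close>

lemma nn_integral_Xbar:
  fixes X :: "'r \<Rightarrow> real" and S G :: "'p \<Rightarrow> real" and H :: "real \<Rightarrow> ennreal"
  assumes \<alpha>: "0 < \<alpha>" "\<alpha> < 1" and \<theta>: "\<theta> > - \<alpha>" and n: "n \<ge> 1"
    and st: "positive_stable R \<alpha> X" and X: "distributed R lborel X (\<lambda>x. ennreal (f x))"
    and nonneg: "\<And>x. f x \<ge> 0"
    and P: "prob_space P"
    and S: "distributed P lborel S (\<lambda>s. ennreal (S_density f \<alpha> \<theta> s))"
    and G: "distributed P lborel G (\<lambda>g. ennreal (gamma_density (\<theta> + real n) g))"
    and ind: "prob_space.indep_var P borel G borel S"
    and [measurable]: "H \<in> borel_measurable borel"
  shows "(\<integral>\<^sup>+\<omega>. H (G \<omega> powr \<alpha> * S \<omega>) \<partial>P) =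
    (\<integral>\<^sup>+z. ennreal (Xbar_density n \<alpha> \<theta> z) * H z \<partial>lborel)"
proof -
  interpret P: prob_space P by (rule P)
  define a where "a = \<theta> + real n"
  define K where "K = Gamma (\<theta> + 1) / (Gamma (\<theta> / \<alpha> + 1) * Gamma a)"
  have a: "a > 0" using \<alpha> \<theta> n by (simp add: a_def)
  have "\<theta> / \<alpha> + 1 > 0" "\<theta> + 1 > 0" using \<alpha> \<theta> by (simp_all add: field_simps)
  then have Gpos: "Gamma (\<theta> / \<alpha> + 1) > 0" "Gamma (\<theta> + 1) > 0" "Gamma a > 0"
    using a by (simp_all add: Gamma_real_pos)
  then have K: "K > 0" by (simp add: K_def)
  have [measurable]: "f \<in> borel_measurable borel"
    using distributed_real_measurable[OF _ X] nonneg by simp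
  have [measurable]: "S_density f \<alpha> \<theta> \<in> borel_measurable borel"
    unfolding S_density_def by measurable
  have [measurable]: "gamma_density a \<in> borel_measurable borel"
    unfolding gamma_density_def by measurable
  have [measurable]: "nb_norm n \<alpha> \<in> borel_measurable borel"
    unfolding nb_norm_def by measurable
  have Spos: "S_density f \<alpha> \<theta> s \<ge> 0" for s
    using Gpos \<alpha> nonneg by (simp add: S_density_def)
  let ?\<Phi> = "\<lambda>s. \<integral>\<^sup>+g. ennreal (gamma_density a g) * H (g powr \<alpha> * s) \<partial>lborel"
  let ?J = "\<lambda>t y. ennreal (K * y powr (a - 1)) * H (y powr \<alpha>) * indicator {0<..} y *
       (ennreal (t ^ n * exp (- y * t) * f t) * indicator {0<..} t)"
  have "(\<integral>\<^sup>+\<omega>. H (G \<omega> powr \<alpha> * S \<omega>) \<partial>P) =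
     (\<integral>\<^sup>+s. ennreal (S_density f \<alpha> \<theta> s) * ?\<Phi> s \<partial>lborel)"
    using G unfolding a_def[symmetric]
    by (intro P.nn_integral_indep_densities[where h = "\<lambda>g s. H (g powr \<alpha> * s)"] ind S) measurable
  also have "\<dots> = (\<integral>\<^sup>+s. ennreal (S_density f \<alpha> \<theta> s) * ?\<Phi> s * indicator {0<..} s \<partial>lborel)"
    by (intro nn_integral_cong) (auto simp: S_density_def split: split_indicator)
  \<comment> \<open>substitution \<open>s = t\<^sup>-\<^sup>\<alpha>\<close>\<close>
  also have "\<dots> = (\<integral>\<^sup>+t. ennreal (S_density f \<alpha> \<theta> (t powr (- \<alpha>))) * ?\<Phi> (t powr (- \<alpha>)) *
       ennreal (\<bar>- \<alpha>\<bar> * t powr (- \<alpha> - 1)) * indicator {0<..} t \<partial>lborel)"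
    using \<alpha> by (intro nn_integral_powr_substitution) simp_all
  also have "\<dots> = (\<integral>\<^sup>+t. (\<integral>\<^sup>+y. ?J t y \<partial>lborel) \<partial>lborel)"
  proof (rule nn_integral_cong)
    fix t :: real
    show "ennreal (S_density f \<alpha> \<theta> (t powr (- \<alpha>))) * ?\<Phi> (t powr (- \<alpha>)) *
       ennreal (\<bar>- \<alpha>\<bar> * t powr (- \<alpha> - 1)) * indicator {0<..} t = (\<integral>\<^sup>+y. ?J t y \<partial>lborel)"
    proof (cases "t > 0")
      case t: True
      let ?c = "Gamma (\<theta> + 1) / Gamma (\<theta> / \<alpha> + 1) * (t powr (- \<theta>) * f t)"
      have c: "?c \<ge> 0" using Gpos nonneg by simp
      have Sc: "ennreal (S_density f \<alpha> \<theta> (t powr (- \<alpha>))) * ennreal (\<alpha> * t powr (- \<alpha> - 1)) = ennreal ?c"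
        using S_density_powr[OF \<alpha>(1) t, of f \<theta>] Spos \<alpha> by (simp add: ennreal_mult'[symmetric])
      have "ennreal (S_density f \<alpha> \<theta> (t powr (- \<alpha>))) * ?\<Phi> (t powr (- \<alpha>)) *
         ennreal (\<bar>- \<alpha>\<bar> * t powr (- \<alpha> - 1)) * indicator {0<..} t =
         ennreal (S_density f \<alpha> \<theta> (t powr (- \<alpha>))) * ?\<Phi> (t powr (- \<alpha>)) * ennreal (\<alpha> * t powr (- \<alpha> - 1))"
        using t \<alpha> by simp
      also have "\<dots> = ennreal (S_density f \<alpha> \<theta> (t powr (- \<alpha>))) * ennreal (\<alpha> * t powr (- \<alpha> - 1)) *
          ?\<Phi> (t powr (- \<alpha>))"
        by (simp only: mult.assoc mult.commute[of "?\<Phi> (t powr (- \<alpha>))"])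
      also have "\<dots> = ennreal ?c * ?\<Phi> (t powr (- \<alpha>))"
        by (simp only: Sc)
      also have "\<dots> = (\<integral>\<^sup>+y. ennreal ?c * (ennreal (t powr a * y powr (a - 1) * exp (- y * t) / Gamma a)
          * H (y powr \<alpha>) * indicator {0<..} y) \<partial>lborel)"
        unfolding gamma_density_scale[OF \<alpha>(1) t \<open>H \<in> borel_measurable borel\<close>]
        by (rule nn_integral_cmult[symmetric]) measurable
      also have "\<dots> = (\<integral>\<^sup>+y. ?J t y \<partial>lborel)"
      proof (rule nn_integral_cong)
        fix y :: real
        have "?c * (t powr a * y powr (a - 1) * exp (- y * t) / Gamma a) =
            K * y powr (a - 1) * (t ^ n * exp (- y * t) * f t)"
        proof -
          have "t powr (- \<theta>) * t powr a = t ^ n"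
            using t by (simp add: a_def powr_realpow flip: powr_add)
          then show ?thesis unfolding K_def by (simp add: field_simps)
        qed
        moreover have "K * y powr (a - 1) \<ge> 0" using K by simp
        moreover have "t ^ n * exp (- y * t) * f t \<ge> 0" using t nonneg by simp
        ultimately have "ennreal ?c * ennreal (t powr a * y powr (a - 1) * exp (- y * t) / Gamma a) =
            ennreal (K * y powr (a - 1)) * ennreal (t ^ n * exp (- y * t) * f t)"
          using c by (simp only: ennreal_mult'[symmetric])
        then show "ennreal ?c * (ennreal (t powr a * y powr (a - 1) * exp (- y * t) / Gamma a)
          * H (y powr \<alpha>) * indicator {0<..} y) = ?J t y"
          using t by (simp add: mult_ac)
      qed
      finally show ?thesis .
    qed simp
  qed
  also have "\<dots> = (\<integral>\<^sup>+y. (\<integral>\<^sup>+t. ?J t y \<partial>lborel) \<partial>lborel)"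
    by (rule lborel_pair.Fubini'[symmetric]) measurable
  also have "\<dots> = (\<integral>\<^sup>+y. ennreal (Xbar_density n \<alpha> \<theta> (y powr \<alpha>)) * H (y powr \<alpha>) *
       ennreal (\<bar>\<alpha>\<bar> * y powr (\<alpha> - 1)) * indicator {0<..} y \<partial>lborel)"
  proof (rule nn_integral_cong)
    fix y :: real
    show "(\<integral>\<^sup>+t. ?J t y \<partial>lborel) = ennreal (Xbar_density n \<alpha> \<theta> (y powr \<alpha>)) * H (y powr \<alpha>) *
       ennreal (\<bar>\<alpha>\<bar> * y powr (\<alpha> - 1)) * indicator {0<..} y"
    proof (cases "y > 0")
      case y: True
      let ?L = "exp (- (y powr \<alpha>)) * y powr (- real n) * nb_norm n \<alpha> (y powr \<alpha>)"
      have "(\<integral>\<^sup>+t. ?J t y \<partial>lborel) = ennreal (K * y powr (a - 1)) * H (y powr \<alpha>) * indicator {0<..} y *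
          (\<integral>\<^sup>+t. ennreal (t ^ n * exp (- y * t) * f t) * indicator {0<..} t \<partial>lborel)"
        by (rule nn_integral_cmult) measurable
      also have "\<dots> = ennreal (K * y powr (a - 1)) * ennreal ?L * H (y powr \<alpha>)"
        unfolding nn_integral_tilted_moment[OF st X nonneg y] using y by (simp add: mult_ac)
      also have "ennreal (K * y powr (a - 1)) * ennreal ?L = ennreal (K * y powr (a - 1) * ?L)"
        using K by (intro ennreal_mult'[symmetric]) simp
      also have "K * y powr (a - 1) * ?L =
        Xbar_density n \<alpha> \<theta> (y powr \<alpha>) * (\<bar>\<alpha>\<bar> * y powr (\<alpha> - 1))"
      proof -
        have "y powr (a - 1) * y powr (- real n) = y powr (\<theta> - 1)"
          by (simp add: a_def flip: powr_add)
        moreover have "(y powr \<alpha>) powr (\<theta> / \<alpha> - 1) * y powr (\<alpha> - 1) = y powr (\<theta> - 1)"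
        proof -
          have "\<alpha> * (\<theta> / \<alpha> - 1) + (\<alpha> - 1) = \<theta> - 1" using \<alpha> by (simp add: field_simps)
          then show ?thesis by (simp only: powr_powr flip: powr_add)
        qed
        ultimately have "y powr (a - 1) * y powr (- real n) =
            (y powr \<alpha>) powr (\<theta> / \<alpha> - 1) * y powr (\<alpha> - 1)" by simp
        then show ?thesis
          using \<alpha> y Gpos by (simp add: Xbar_density_def K_def a_def[symmetric] field_simps)
      qed
      also have "ennreal (Xbar_density n \<alpha> \<theta> (y powr \<alpha>) * (\<bar>\<alpha>\<bar> * y powr (\<alpha> - 1))) =
         ennreal (Xbar_density n \<alpha> \<theta> (y powr \<alpha>)) * ennreal (\<bar>\<alpha>\<bar> * y powr (\<alpha> - 1))"
        using \<alpha> by (intro ennreal_mult'') simp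
      finally show ?thesis using y by (simp add: mult_ac)
    qed simp
  qed
  \<comment> \<open>substitution \<open>z = y\<^sup>\<alpha>\<close>, read backwards\<close>
  also have "\<dots> = (\<integral>\<^sup>+z. ennreal (Xbar_density n \<alpha> \<theta> z) * H z * indicator {0<..} z \<partial>lborel)"
    using \<alpha> unfolding Xbar_density_def
    by (intro nn_integral_powr_substitution[symmetric]) simp_all
  also have "\<dots> = (\<integral>\<^sup>+z. ennreal (Xbar_density n \<alpha> \<theta> z) * H z \<partial>lborel)"
    by (intro nn_integral_cong) (auto simp: Xbar_density_def split: split_indicator)
  finally show ?thesis .
qed

lemma nn_integral_Gamma:
  assumes "s > (0::real)"
  shows "(\<integral>\<^sup>+t. ennreal (t powr (s - 1) * exp (- t)) * indicator {0<..} t \<partial>lborel) = ennreal (Gamma s)"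
proof -
  have "ennreal (Gamma s) = (\<integral>\<^sup>+t. ennreal (indicator {0..} t * t powr (s - 1) / exp t) \<partial>lborel)"
    by (rule Gamma_conv_nn_integral_real[OF assms])
  also have "\<dots> = (\<integral>\<^sup>+t. ennreal (t powr (s - 1) * exp (- t)) * indicator {0<..} t \<partial>lborel)"
    by (intro nn_integral_cong)
       (auto simp: exp_minus field_simps split: split_indicator)
  finally show ?thesis ..
qed

lemma EP_ratio_Gamma:
  assumes \<alpha>: "0 < \<alpha>" "\<alpha> < 1" and \<theta>: "\<theta> > - \<alpha>" and n: "n \<ge> 1" and k: "k \<ge> 1"
  shows "EP_ratio n \<alpha> \<theta> k = Gamma (\<theta> + 1) / (\<alpha> * Gamma (\<theta> / \<alpha> + 1) * Gamma (\<theta> + real n)) *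
     Gamma (\<theta> / \<alpha> + real k)"
proof -
  have p: "\<theta> / \<alpha> + 1 > 0" "\<theta> + 1 > 0" using \<alpha> \<theta> by (simp_all add: field_simps)
  have "pochhammer (\<theta> / \<alpha> + 1) (k - 1) = Gamma (\<theta> / \<alpha> + 1 + real (k - 1)) / Gamma (\<theta> / \<alpha> + 1)"
    using p by (intro pochhammer_Gamma) (auto elim!: nonpos_Ints_cases)
  moreover have "pochhammer (\<theta> + 1) (n - 1) = Gamma (\<theta> + 1 + real (n - 1)) / Gamma (\<theta> + 1)"
    using p by (intro pochhammer_Gamma) (auto elim!: nonpos_Ints_cases)
  ultimately show ?thesis
    using \<alpha> n k by (simp add: EP_ratio_eq of_nat_diff mult_ac)
qed

text \<open>
  The factor \<open>S\<^sub>n(z)\<close> of the density cancels the denominator of the NB-CPSM mass. What is left of the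
  mixture is the Gamma integral of \<open>z powr (\<theta>/\<alpha> + k - 1)\<close>, whose value is the EP-SM ratio by
  \<open>EP_ratio_Gamma\<close>.
\<close>

theorem EP_SM_eq_NB_CPSM_mixture:
  fixes X :: "'r \<Rightarrow> real" and S G :: "'p \<Rightarrow> real" and Xbar :: "'q \<Rightarrow> real"
  assumes \<alpha>: "0 < \<alpha>" "\<alpha> < 1" and \<theta>: "\<theta> > - \<alpha>" and n: "n \<ge> 1"
    and st: "positive_stable R \<alpha> X" and X: "distributed R lborel X (\<lambda>x. ennreal (f x))"
    and nonneg: "\<And>x. f x \<ge> 0"
    and P: "prob_space P"
    and S: "distributed P lborel S (\<lambda>s. ennreal (S_density f \<alpha> \<theta> s))"
    and G: "distributed P lborel G (\<lambda>g. ennreal (gamma_density (\<theta> + real n) g))"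
    and ind: "prob_space.indep_var P borel G borel S"
    and Xbar [measurable]: "Xbar \<in> borel_measurable Q"
    and law: "distr Q borel Xbar = distr P borel (\<lambda>\<omega>. G \<omega> powr \<alpha> * S \<omega>)"
  shows "pmf (EP_SM n \<alpha> \<theta>) x = (\<integral>\<omega>. pmf (NB_CPSM n \<alpha> (Xbar \<omega>)) x \<partial>Q)"
proof -
  have EP: "EP_params \<alpha> \<theta>" using \<alpha> \<theta> by (simp add: EP_params_def)
  let ?h = "\<lambda>z. pmf (NB_CPSM n \<alpha> z) x"
  have h_eq: "?h z = (if z > 0 then NB_CPSM_mass n \<alpha> z x else pmf (return_pmf (\<lambda>_. 0)) x)" for z
    using \<alpha> by (simp add: pmf_NB_CPSM NB_params_def) (simp add: NB_CPSM_def NB_params_def)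
  have [measurable]: "?h \<in> borel_measurable borel"
    unfolding h_eq NB_CPSM_mass_def by measurable
  have [measurable]: "G \<in> borel_measurable P" "S \<in> borel_measurable P"
    using distributed_lborel_density(2)[OF G] distributed_lborel_density(2)[OF S] .
  have "(\<integral>\<^sup>+\<omega>. ennreal (?h (Xbar \<omega>)) \<partial>Q) = (\<integral>\<^sup>+z. ennreal (?h z) \<partial>distr Q borel Xbar)"
    by (simp add: nn_integral_distr)
  also have "\<dots> = (\<integral>\<^sup>+\<omega>. ennreal (?h (G \<omega> powr \<alpha> * S \<omega>)) \<partial>P)"
    unfolding law by (simp add: nn_integral_distr)
  also have "\<dots> = (\<integral>\<^sup>+z. ennreal (Xbar_density n \<alpha> \<theta> z) * ennreal (?h z) \<partial>lborel)"
    by (rule nn_integral_Xbar[OF \<alpha> \<theta> n st X nonneg P S G ind]) measurable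
  also have "\<dots> = ennreal (EP_SM_mass n \<alpha> \<theta> x)"
  proof (cases "x \<in> count_vectors n")
    case False
    then have zero: "ennreal (Xbar_density n \<alpha> \<theta> z) * ennreal (?h z) = 0" for z
      by (simp add: h_eq Xbar_density_def NB_CPSM_mass_def)
    show ?thesis unfolding zero using False by (simp add: EP_SM_mass_def)
  next
    case x: True
    let ?k = "\<Sum>i=1..n. x i"
    let ?W = "\<Prod>i=1..n. block_weight \<alpha> i ^ x i / fact (x i)"
    let ?D = "Gamma (\<theta> + 1) / (\<alpha> * Gamma (\<theta> / \<alpha> + 1) * Gamma (\<theta> + real n))"
    have k: "?k \<ge> 1" using block_number_pos[OF x n] .
    have p: "\<theta> / \<alpha> + 1 > 0" "\<theta> + 1 > 0" "\<theta> + real n > 0" using \<alpha> \<theta> n by (simp_all add: field_simps)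
    have s: "\<theta> / \<alpha> + real ?k > 0" using p(1) k by linarith
    have D: "?D * fact n * ?W \<ge> 0"
      using p \<alpha> block_weight_pos[OF \<alpha>] by (auto intro!: mult_nonneg_nonneg divide_nonneg_nonneg prod_nonneg simp: less_imp_le Gamma_real_pos)
    have "ennreal (Xbar_density n \<alpha> \<theta> z) * ennreal (?h z) =
       ennreal (?D * fact n * ?W) * (ennreal (z powr (\<theta> / \<alpha> + real ?k - 1) * exp (- z)) * indicator {0<..} z)" for z
    proof (cases "z > 0")
      case z: True
      have nb: "nb_norm n \<alpha> z > 0" using z \<alpha> by (intro nb_norm_pos) (simp add: NB_params_def)
      have "z powr (\<theta> / \<alpha> + real ?k - 1) = z powr (\<theta> / \<alpha> - 1) * z ^ ?k"
        using z by (simp add: algebra_simps flip: powr_realpow powr_add)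
      then have "Xbar_density n \<alpha> \<theta> z * NB_CPSM_mass n \<alpha> z x =
          ?D * fact n * ?W * (z powr (\<theta> / \<alpha> + real ?k - 1) * exp (- z))"
        using z nb unfolding NB_CPSM_mass_eq[OF x] by (simp add: Xbar_density_def mult_ac)
      moreover have "NB_CPSM_mass n \<alpha> z x \<ge> 0"
        using z \<alpha> by (intro NB_CPSM_mass_nonneg) (simp add: NB_params_def)
      ultimately show ?thesis
        using z D by (simp add: h_eq ennreal_mult'[symmetric] ennreal_mult''[symmetric])
    qed (simp add: Xbar_density_def)
    then have "(\<integral>\<^sup>+z. ennreal (Xbar_density n \<alpha> \<theta> z) * ennreal (?h z) \<partial>lborel) =
        ennreal (?D * fact n * ?W) * ennreal (Gamma (\<theta> / \<alpha> + real ?k))"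
      by (simp only: nn_integral_Gamma[OF s, symmetric]) (rule nn_integral_cmult, measurable)
    also have "\<dots> = ennreal (?D * fact n * ?W * Gamma (\<theta> / \<alpha> + real ?k))"
      using D by (rule ennreal_mult'[symmetric])
    also have "?D * fact n * ?W * Gamma (\<theta> / \<alpha> + real ?k) = EP_SM_mass n \<alpha> \<theta> x"
      using x unfolding EP_SM_mass_def EP_ratio_Gamma[OF \<alpha> \<theta> n k] by simp
    finally show ?thesis .
  qed
  finally have "(\<integral>\<^sup>+\<omega>. ennreal (?h (Xbar \<omega>)) \<partial>Q) = ennreal (EP_SM_mass n \<alpha> \<theta> x)" .
  then have "(\<integral>\<omega>. ?h (Xbar \<omega>) \<partial>Q) = EP_SM_mass n \<alpha> \<theta> x"
    using EP_SM_mass_nonneg[OF n EP, of x] by (subst integral_eq_nn_integral) auto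
  then show ?thesis by (simp add: pmf_EP_SM[OF n EP])
qed

theorem theorem2:
  fixes n :: nat
    and R :: "'r measure" and P :: "'p measure" and Q :: "'q measure"
  assumes "n \<ge> 1"
  shows
    "(\<forall>(\<alpha>::real) (\<theta>::real) (f :: real \<Rightarrow> real) (X :: 'r \<Rightarrow> real)
        (S :: 'p \<Rightarrow> real) (G :: 'p \<Rightarrow> real) (Xbar :: 'q \<Rightarrow> real).
        0 < \<alpha> \<and> \<alpha> < 1 \<and> \<theta> > - \<alpha> \<and>
        positive_stable R \<alpha> X \<and>
        (\<forall>x. f x \<ge> 0) \<and> distributed R lborel X (\<lambda>x. ennreal (f x)) \<and>
        prob_space P \<and>
        distributed P lborel S (\<lambda>s. ennreal (S_density f \<alpha> \<theta> s)) \<and>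
        distributed P lborel G (\<lambda>g. ennreal (gamma_density (\<theta> + real n) g)) \<and>
        prob_space.indep_var P borel G borel S \<and>
        prob_space Q \<and> Xbar \<in> borel_measurable Q \<and>
        distr Q borel Xbar = distr P borel (\<lambda>\<omega>. G \<omega> powr \<alpha> * S \<omega>) \<longrightarrow>
        (\<forall>x. pmf (EP_SM n \<alpha> \<theta>) x = (\<integral>\<omega>. pmf (NB_CPSM n \<alpha> (Xbar \<omega>)) x \<partial>Q)))
     \<and>
     (\<forall>(\<alpha>::real) (z::real).
        \<alpha> < 0 \<and> z < 0 \<longrightarrow>
        NB_CPSM n \<alpha> z =
          bind_pmf (tilde_X_law n \<alpha> z) (\<lambda>m. EP_SM n \<alpha> (- real m * \<alpha>)))"
proof (intro conjI allI impI)
  fix \<alpha> \<theta> :: real and f :: "real \<Rightarrow> real" and X :: "'r \<Rightarrow> real" and S G :: "'p \<Rightarrow> real"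
    and Xbar :: "'q \<Rightarrow> real" and x
  assume "0 < \<alpha> \<and> \<alpha> < 1 \<and> \<theta> > - \<alpha> \<and>
        positive_stable R \<alpha> X \<and>
        (\<forall>x. f x \<ge> 0) \<and> distributed R lborel X (\<lambda>x. ennreal (f x)) \<and>
        prob_space P \<and>
        distributed P lborel S (\<lambda>s. ennreal (S_density f \<alpha> \<theta> s)) \<and>
        distributed P lborel G (\<lambda>g. ennreal (gamma_density (\<theta> + real n) g)) \<and>
        prob_space.indep_var P borel G borel S \<and>
        prob_space Q \<and> Xbar \<in> borel_measurable Q \<and>
        distr Q borel Xbar = distr P borel (\<lambda>\<omega>. G \<omega> powr \<alpha> * S \<omega>)"
  then show "pmf (EP_SM n \<alpha> \<theta>) x = (\<integral>\<omega>. pmf (NB_CPSM n \<alpha> (Xbar \<omega>)) x \<partial>Q)"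
    by (elim conjE, intro EP_SM_eq_NB_CPSM_mixture[OF _ _ _ assms]) (assumption | erule spec)+
next
  fix \<alpha> z :: real
  assume "\<alpha> < 0 \<and> z < 0"
  then show "NB_CPSM n \<alpha> z = bind_pmf (tilde_X_law n \<alpha> z) (\<lambda>m. EP_SM n \<alpha> (- real m * \<alpha>))"
    using NB_CPSM_eq_EP_SM_mixture[OF assms] by blast
qed

end
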